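(* Let $(w_n)_{n\ge 0}$ and $(v_k)_{k\ge 1}$ be sequences of nonnegative reals with generating function $W(z)=\sum_{n\ge0}w_nz^n$. Assume there are a constant $\rho_w>0$, a constant $\alpha>-1$ and slowly varying functions $L_w,L_v$ such that $$w_n\sim L_w(n)\,n^{-1}\rho_w^{-n},\qquad W(\rho_w)\in(0,\infty),\qquad v_n\sim L_v(n)\,n^{\alpha-1}W(\rho_w)^{-n}\quad(n\to\infty).$$ Let $X$ be a nonnegative integer random variable with $\mathbb{E}[z^X]=W(\rho_w z)/W(\rho_w)$. For $n$ with $0<u_n<\infty$, let $(K_1,\dots,K_{N_n})$ be distributed according to the Gibbs partition model $\mathbb{P}_n$ (see context), so $N_n$ is the number of components. Then: (i) uniformly for all integers $k=x/\mathbb{P}(X>n)$ with $x$ restricted to a compact subset of $(0,\infty)$, $$\mathbb{P}(N_n=k)\sim \mathbb{P}(X>n)\,x^\alpha e^{-x}/\Gamma(\alpha+1);$$ (ii) $N_n\,\mathbb{P}(X>n)$ converges in distribution to a $\mathrm{Gamma}(\alpha+1,1)$-distributed random variable $Z$; (iii) for each $q\ge1$, $\mathbb{E}[N_n^q]\sim \mathbb{P}(X>n)^{-q}\,\Gamma(q+\alpha+1)/\Gamma(\alpha+1)$.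
   Context: For $k\ge1$ set $w_n^{(k)}=\sum_{n_1+\dots+n_k=n,\ n_i\ge0}\prod_{i=1}^k w_{n_i}$ and $u_n=\sum_{k\ge1}v_k w_n^{(k)}$. For $n$ with $0<u_n<\infty$, the Gibbs partition model is the probability measure on finite sequences $(n_1,\dots,n_k)$ ($k\ge1$) of nonnegative integers summing to $n$ given by $\mathbb{P}_n(n_1,\dots,n_k)=v_k\prod_{i=1}^k w_{n_i}/u_n$. A random sequence $(K_1,\dots,K_{N_n})$ with law $\mathbb{P}_n$ has "components" $K_i$, and $N_n$ is its (random) length. All limits are as $n\to\infty$ along $n$ with $0<u_n<\infty$. *)

theory Defs
  imports "HOL-Analysis.Analysis" "HOL-Library.Landau_Symbols"
begin

definition slowly_varying :: "(real \<Rightarrow> real) \<Rightarrow> bool" where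
  "slowly_varying L \<longleftrightarrow> L \<in> borel_measurable borel \<and> (\<forall>\<^sub>F x in at_top. L x > 0) \<and>
     (\<forall>c>0. ((\<lambda>x. L (c * x) / L x) \<longlongrightarrow> 1) at_top)"

definition comps :: "nat \<Rightarrow> nat \<Rightarrow> nat list set" where
  "comps k n = {xs. length xs = k \<and> sum_list xs = n}"

definition wconv :: "(nat \<Rightarrow> real) \<Rightarrow> nat \<Rightarrow> nat \<Rightarrow> real" where
  "wconv w k n = (\<Sum>xs\<in>comps k n. prod_list (map w xs))"

definition gibbs_u :: "(nat \<Rightarrow> real) \<Rightarrow> (nat \<Rightarrow> real) \<Rightarrow> nat \<Rightarrow> real" where
  "gibbs_u v w n = (\<Sum>k. v (Suc k) * wconv w (Suc k) n)"

text \<open>0 < u_n < infinity (terms are nonnegative, so finiteness = summability)\<close>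
definition gibbs_admissible :: "(nat \<Rightarrow> real) \<Rightarrow> (nat \<Rightarrow> real) \<Rightarrow> nat \<Rightarrow> bool" where
  "gibbs_admissible v w n \<longleftrightarrow>
     summable (\<lambda>k. v (Suc k) * wconv w (Suc k) n) \<and> gibbs_u v w n > 0"

definition gibbs_prob :: "(nat \<Rightarrow> real) \<Rightarrow> (nat \<Rightarrow> real) \<Rightarrow> nat \<Rightarrow> nat \<Rightarrow> real" where
  "gibbs_prob v w n k = (if k = 0 then 0 else v k * wconv w k n / gibbs_u v w n)"

definition gen_fun :: "(nat \<Rightarrow> real) \<Rightarrow> real \<Rightarrow> real" where
  "gen_fun w r = (\<Sum>m. w m * r ^ m)"

text \<open>P(X > n), where P(X = m) = w_m rho^m / W(rho), i.e. E[z^X] = W(rho z)/W(rho)\<close>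
definition tail_X :: "(nat \<Rightarrow> real) \<Rightarrow> real \<Rightarrow> nat \<Rightarrow> real" where
  "tail_X w \<rho> n = (\<Sum>m. if n < m then w m * \<rho> ^ m else 0) / gen_fun w \<rho>"

definition gamma_cdf :: "real \<Rightarrow> real \<Rightarrow> real" where
  "gamma_cdf a x = (if x \<le> 0 then 0 else
     set_lebesgue_integral lborel {0..x} (\<lambda>t. t powr (a - 1) * exp (- t)) / Gamma a)"

end

theory Submission
  imports Defs
begin

text \<open>
  Put \<open>p\<^sub>m = w\<^sub>m \<rho>\<^sup>m / W(\<rho>)\<close>, let \<open>S\<^sub>k\<close> be a sum of \<open>k\<close> independent copies of \<open>X\<close> and
  \<open>T(n) = P(X > n)\<close>. Then \<open>P(N\<^sub>n = k)\<close> is proportional to \<open>v\<^sub>k W(\<rho>)\<^sup>k P(S\<^sub>k = n)\<close>, so everything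
  rests on the local asymptotics \<open>P(S\<^sub>k = n) \<sim> k p\<^sub>n exp(- k T(n))\<close> for \<open>k\<close> of order \<open>1 / T(n)\<close>:
  one summand is close to \<open>n\<close> and the others stay below it. It comes from the size-bias
  identity \<open>n P(S\<^sub>k = n) = k \<Sum>\<^sub>m m p\<^sub>m P(S\<^bsub>k-1\<^esub> = n - m)\<close>, in which \<open>m p\<^sub>m\<close> is slowly varying: the
  terms with \<open>m \<ge> n / 2\<close> give \<open>n p\<^sub>n P(S\<^bsub>k-1\<^esub> \<le> n / 2)\<close>, and the remaining ones are negligible since
  \<open>n p\<^sub>n / T(n) \<rightarrow> 0\<close>. The same identity gives, by induction on \<open>k\<close>, the bound
  \<open>P(S\<^sub>k = n) \<le> B k p\<^sub>n exp(- k T(n) / 2)\<close> uniformly in \<open>k\<close>. With \<open>x = k T(n)\<close> the sums over \<open>k\<close>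
  are Riemann sums for \<open>x\<^sup>\<alpha> e\<^sup>-\<^sup>x\<close>, and this bound together with Potter's bound for \<open>L\<^sub>v\<close>
  justifies dominated convergence.
\<close>

subsection \<open>Slowly varying functions\<close>

text \<open>The obstacle is uniformity in \<open>k\<close>. Feeding a bound
  \<open>conv k n \<le> B * k * M n / n\<close> into the size-bias identity leaves, from the indices
  below \<open>n / 2\<close>, an error with the extra factor \<open>k * M n\<close>, unbounded in
  \<open>k\<close>, so a plain induction would let \<open>B\<close> grow. Halving \<open>k\<close>
  first supplies \<open>exp (- (k * T(n) / 2))\<close>; since \<open>x * exp (- (x / 2))\<close> is
  bounded, \<open>k * M n\<close> is traded for \<open>M n / T(n)\<close>, which tends to 0, and the
  same \<open>B\<close> closes the induction. The weights may vanish at small indices, and a slowly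
  varying function need not be positive or bounded there. It is replaced by positive functions,
  \<open>M\<close> and \<open>V\<close>, that agree with it eventually and obey Potter's bound at
  all positive arguments. For \<alpha> < 0 the limit density blows up at 0; the Potter exponent
  (\<alpha> + 1) / 2 is chosen so that the majorant keeps an integrable singularity.\<close>

lemma slowly_varying_ln_diff_tendsto:
  assumes "slowly_varying L"
  shows "((\<lambda>x. ln (L (exp (x + y))) - ln (L (exp x))) \<longlongrightarrow> 0) at_top"
proof -
  have pos: "\<forall>\<^sub>F x in at_top. L x > 0"
    and lim: "((\<lambda>x. L (exp y * x) / L x) \<longlongrightarrow> 1) at_top"
    using assms by (auto simp: slowly_varying_def)
  have pos_exp: "\<forall>\<^sub>F x in at_top. L (exp x) > 0"
    using eventually_compose_filterlim[OF pos exp_at_top] .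
  moreover have "filterlim (\<lambda>x. exp (x + y)) at_top at_top"
    using filterlim_tendsto_add_at_top[OF tendsto_const filterlim_ident, of y]
    by (intro filterlim_compose[OF exp_at_top]) (simp add: add.commute)
  then have pos_exp': "\<forall>\<^sub>F x in at_top. L (exp (x + y)) > 0"
    using eventually_compose_filterlim[OF pos] by blast
  have "((\<lambda>x. ln (L (exp y * exp x) / L (exp x))) \<longlongrightarrow> ln 1) at_top"
    by (intro tendsto_ln filterlim_compose[OF lim exp_at_top]) auto
  moreover have "\<forall>\<^sub>F x in at_top. ln (L (exp y * exp x) / L (exp x)) = ln (L (exp (x + y))) - ln (L (exp x))"
    using pos_exp pos_exp' by eventually_elim (simp add: ln_div exp_add mult.commute)
  ultimately show ?thesis
    using Lim_transform_eventually by fastforce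
qed

text \<open>Averaging over the shift turns pointwise into uniform convergence: if \<open>\<Phi> x\<close> is the integral
  of \<open>min 1 \<bar>h (x + y) - h x\<bar>\<close> over \<open>0 \<le> y \<le> 2 A\<close> then \<open>A * min 1 \<bar>h (x + u) - h x\<bar> \<le> \<Phi> x + \<Phi> (x + u)\<close>.\<close>

lemma slowly_varying_ln_uniform:
  assumes L: "slowly_varying L" and A: "A > 0" and \<epsilon>: "\<epsilon> > 0"
  shows "\<forall>\<^sub>F x in at_top. \<forall>u\<in>{0..A}. \<bar>ln (L (exp (x + u))) - ln (L (exp x))\<bar> < \<epsilon>"
proof -
  define h where "h = (\<lambda>x. ln (L (exp x)))"
  have L_meas [measurable]: "L \<in> borel_measurable borel"
    using L by (simp add: slowly_varying_def)
  have h_meas [measurable]: "h \<in> borel_measurable borel"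
    unfolding h_def by measurable
  \<comment> \<open>Truncation at 1 provides an integrable majorant on \<open>{0..2 * A}\<close>
    although nothing bounds \<open>h\<close> in advance.\<close>
  define g where "g = (\<lambda>x y. indicator {0..2 * A} y * min 1 \<bar>h (x + y) - h x\<bar>)"
  have g_meas [measurable]: "g x \<in> borel_measurable lborel" for x
    unfolding g_def by measurable
  have dom_int: "integrable lborel (\<lambda>y. indicator {0..2 * A} y :: real)"
    using A by (intro integrable_real_indicator) auto
  have g_int: "integrable lborel (g x)" for x
    by (rule Bochner_Integration.integrable_bound[OF dom_int]) (auto simp: g_def indicator_def)
  have lim: "((\<lambda>x. \<integral>y. g x y \<partial>lborel) \<longlongrightarrow> (\<integral>y. 0 \<partial>(lborel::real measure))) at_top"
  proof (rule integral_dominated_convergence_at_top[OF _ _ dom_int])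
    show "\<forall>\<^sub>F x in at_top. AE y in lborel. norm (g x y) \<le> indicator {0..2 * A} y"
      by (auto simp: g_def indicator_def)
    show "AE y in lborel. ((\<lambda>x. g x y) \<longlongrightarrow> 0) at_top"
    proof (rule AE_I2)
      fix y
      have "((\<lambda>x. indicator {0..2 * A} y * min 1 \<bar>h (x + y) - h x\<bar>) \<longlongrightarrow>
               indicator {0..2 * A} y * min 1 \<bar>0::real\<bar>) at_top"
        unfolding h_def using slowly_varying_ln_diff_tendsto[OF L, of y] by (intro tendsto_intros)
      then show "((\<lambda>x. g x y) \<longlongrightarrow> 0) at_top" by (simp add: g_def)
    qed
  qed auto
  define \<Phi> where "\<Phi> = (\<lambda>x. \<integral>y. g x y \<partial>lborel)"
  \<comment> \<open>Chosen so that \<open>e + e = A * min 1 \<epsilon>\<close>; a strict bound by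
    this excludes the truncated value 1.\<close>
  define e where "e = A * min 1 \<epsilon> / 2"
  have e: "e > 0" using A \<epsilon> by (simp add: e_def)
  have "\<forall>\<^sub>F x in at_top. \<Phi> x < e"
    using order_tendstoD(2)[OF lim, of e] e by (simp add: \<Phi>_def)
  then obtain X where X: "\<Phi> x < e" if "x \<ge> X" for x
    unfolding eventually_at_top_linorder by blast
  \<comment> \<open>For \<open>y\<close> in \<open>{u..u + A}\<close> the point \<open>x + y\<close>
    lies at a shift in \<open>{0..2 * A}\<close> from both \<open>x\<close> and
    \<open>x + u\<close>. The triangle inequality, which survives the truncation, bounds the
    constant on this interval of length \<open>A\<close> by the two integrands.\<close>
  have key: "A * min 1 \<bar>h (x + u) - h x\<bar> \<le> \<Phi> x + \<Phi> (x + u)" if u: "u \<in> {0..A}" for x u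
  proof -
    have shift_int: "integrable lborel (\<lambda>y. g (x + u) (y - u))"
      using lborel_integrable_real_affine[OF g_int[of "x + u"], of 1 "- u"] by simp
    have "A * min 1 \<bar>h (x + u) - h x\<bar> =
        (\<integral>y. indicator {u..u + A} y * min 1 \<bar>h (x + u) - h x\<bar> \<partial>lborel)"
      using A by simp
    also have "\<dots> \<le> (\<integral>y. g x y + g (x + u) (y - u) \<partial>lborel)"
    proof (rule integral_mono)
      show "integrable lborel (\<lambda>y. indicator {u..u + A} y * min 1 \<bar>h (x + u) - h x\<bar>)"
        using A by (intro integrable_mult_left integrable_real_indicator) auto
      show "integrable lborel (\<lambda>y. g x y + g (x + u) (y - u))"
        using g_int shift_int by simp
      fix y :: real
      show "indicator {u..u + A} y * min 1 \<bar>h (x + u) - h x\<bar> \<le> g x y + g (x + u) (y - u)"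
      proof (cases "y \<in> {u..u + A}")
        case True
        then show ?thesis using u A by (auto simp: g_def indicator_def algebra_simps)
      qed (auto simp: g_def indicator_def)
    qed
    also have "\<dots> = \<Phi> x + (\<integral>y. g (x + u) (y - u) \<partial>lborel)"
      using g_int shift_int by (simp add: \<Phi>_def)
    also have "(\<integral>y. g (x + u) (y - u) \<partial>lborel) = \<Phi> (x + u)"
      using lborel_integral_real_affine[of 1 "g (x + u)" "- u"] by (simp add: \<Phi>_def)
    finally show ?thesis .
  qed
  have "\<bar>h (x + u) - h x\<bar> < \<epsilon>" if "x \<ge> X" "u \<in> {0..A}" for x u
  proof -
    have "A * min 1 \<bar>h (x + u) - h x\<bar> < e + e"
      using key[of u x] X[of x] X[of "x + u"] that by auto
    then have "A * min 1 \<bar>h (x + u) - h x\<bar> < A * min 1 \<epsilon>" by (simp add: e_def)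
    then show ?thesis using A by (simp add: min_def split: if_splits)
  qed
  then show ?thesis
    unfolding eventually_at_top_linorder h_def by blast
qed

text \<open>The uniform convergence theorem. The additive version covers only nonnegative shifts, so
  \<open>t * x\<close> and \<open>x\<close> are both compared with \<open>c * x\<close>, where
  \<open>c = min a 1\<close> puts it below either of them.\<close>

lemma slowly_varying_ratio_uniform:
  assumes L: "slowly_varying L" and a: "0 < a" and \<epsilon>: "\<epsilon> > 0"
  shows "\<forall>\<^sub>F x in at_top. \<forall>t\<in>{a..b}. \<bar>L (t * x) / L x - 1\<bar> < \<epsilon>"
proof -
  define c where "c = min a 1"
  define d where "d = max b 1"
  have c: "0 < c" "c \<le> 1" "c \<le> a" and d: "1 \<le> d" "b \<le> d"
    using a by (auto simp: c_def d_def)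
  define h where "h = (\<lambda>x. ln (L (exp x)))"
  obtain \<eta> where \<eta>: "\<eta> > 0" "\<And>z::real. \<bar>z\<bar> < \<eta> \<Longrightarrow> \<bar>exp z - 1\<bar> < \<epsilon>"
  proof -
    have "isCont (exp :: real \<Rightarrow> real) 0" by simp
    from this[unfolded continuous_at_eps_delta, rule_format, OF \<epsilon>] show ?thesis
      using that by (auto simp: dist_real_def)
  qed
  \<comment> \<open>Long enough for the shifts \<open>ln t - ln c\<close> and \<open>- ln c\<close>;
    the added 1 keeps it positive when \<open>c = d\<close>.\<close>
  define A where "A = ln (d / c) + 1"
  have A: "A > 0" using c d by (simp add: A_def add_nonneg_pos)
  have "\<forall>\<^sub>F x in at_top. \<forall>u\<in>{0..A}. \<bar>h (x + u) - h x\<bar> < \<eta> / 2"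
    unfolding h_def using slowly_varying_ln_uniform[OF L A, of "\<eta> / 2"] \<eta> by simp
  then obtain X where X: "\<And>x u. x \<ge> X \<Longrightarrow> u \<in> {0..A} \<Longrightarrow> \<bar>h (x + u) - h x\<bar> < \<eta> / 2"
    unfolding eventually_at_top_linorder by blast
  obtain Y where Y: "\<And>x. x \<ge> Y \<Longrightarrow> L x > 0"
    using L by (auto simp: slowly_varying_def eventually_at_top_linorder)
  have "\<bar>L (t * x) / L x - 1\<bar> < \<epsilon>"
    if x: "x \<ge> max (max 1 Y) (exp X) / c" and t: "t \<in> {a..b}" for x t
  proof -
    have cx: "c * x \<ge> max (max 1 Y) (exp X)"
      using x c by (simp add: field_simps)
    have x0: "x > 0" using cx c by (smt (verit) mult_nonneg_nonpos)
    have t0: "t > 0" "c \<le> t" "t \<le> d" using t a c d by auto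
    have tx: "t * x \<ge> c * x" "x \<ge> c * x" using x0 t0 c by (auto simp: mult_left_le_one_le)
    have pos: "L (t * x) > 0" "L x > 0" using Y cx tx by (smt (verit))+
    have "X \<le> ln (c * x)" using cx c x0 by (simp add: ln_ge_iff)
    have AA: "ln t - ln c \<in> {0..A}" "- ln c \<in> {0..A}"
      using c d t0 by (auto simp: A_def ln_div intro: order.trans[of _ "ln d"])
    have "\<bar>h (ln (t * x)) - h (ln (c * x))\<bar> < \<eta> / 2" "\<bar>h (ln x) - h (ln (c * x))\<bar> < \<eta> / 2"
      using X[OF \<open>X \<le> ln (c * x)\<close> AA(1)] X[OF \<open>X \<le> ln (c * x)\<close> AA(2)] c x0 t0
      by (simp_all add: ln_mult add_ac)
    then have "\<bar>h (ln (t * x)) - h (ln x)\<bar> < \<eta>" by linarith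
    moreover have "exp (h (ln (t * x)) - h (ln x)) = L (t * x) / L x"
      using pos x0 t0 by (simp add: h_def exp_diff)
    ultimately show ?thesis using \<eta>(2) by metis
  qed
  then show ?thesis unfolding eventually_at_top_linorder by blast
qed

text \<open>Potter's bound. Iterating the uniform estimate over unit shifts lets
  \<open>ln (L (exp x))\<close> grow at most linearly with slope \<delta>; rounding the number of
  steps up costs the factor \<open>exp \<delta>\<close>. Freezing the function to the left of a
  threshold extends the bound from large arguments to all positive ones.\<close>

lemma slowly_varying_potter:
  assumes L: "slowly_varying L" and \<delta>: "\<delta> > 0"
  obtains M where "\<And>x. M x > 0" and "\<forall>\<^sub>F x in at_top. M x = L x"
    and "\<And>x y. x > 0 \<Longrightarrow> y > 0 \<Longrightarrow> M y \<le> exp \<delta> * max (y / x) (x / y) powr \<delta> * M x"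
proof -
  define h where "h = (\<lambda>x. ln (L (exp x)))"
  have "\<forall>\<^sub>F x in at_top. \<forall>u\<in>{0..1}. \<bar>h (x + u) - h x\<bar> < \<delta>"
    unfolding h_def using slowly_varying_ln_uniform[OF L _ \<delta>, of 1] by simp
  then obtain X where X: "\<And>x u. x \<ge> X \<Longrightarrow> u \<in> {0..1} \<Longrightarrow> \<bar>h (x + u) - h x\<bar> < \<delta>"
    unfolding eventually_at_top_linorder by blast
  have step: "\<bar>h (x + u) - h x\<bar> \<le> \<delta> * real n" if "x \<ge> X" "0 \<le> u" "u \<le> real n" for x u n
    using that(2,3)
  proof (induction n arbitrary: u)
    case (Suc n)
    show ?case
    proof (cases "u \<le> 1")
      case True
      then have "\<bar>h (x + u) - h x\<bar> < \<delta> * 1" using X[of x u] Suc.prems \<open>x \<ge> X\<close> by simp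
      also have "\<dots> \<le> \<delta> * real (Suc n)" using \<delta> by (intro mult_left_mono) auto
      finally show ?thesis by simp
    next
      case False
      then have "\<bar>h (x + (u - 1)) - h x\<bar> \<le> \<delta> * real n" using Suc by auto
      moreover have "\<bar>h ((x + (u - 1)) + 1) - h (x + (u - 1))\<bar> < \<delta>"
        using X[of "x + (u - 1)" 1] \<open>x \<ge> X\<close> False by simp
      ultimately show ?thesis by (simp add: algebra_simps)
    qed
  qed simp
  have osc: "\<bar>h y - h x\<bar> \<le> \<delta> * (\<bar>y - x\<bar> + 1)" if "x \<ge> X" "y \<ge> X" for x y
  proof -
    have ub: "real (nat \<lceil>u\<rceil>) \<le> u + 1" if "u \<ge> 0" for u :: real using that by linarith
    have 1: "\<bar>h (x + u) - h x\<bar> \<le> \<delta> * (u + 1)" if "x \<ge> X" "0 \<le> u" for x u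
      using step[OF that, of "nat \<lceil>u\<rceil>"] mult_left_mono[OF ub[OF that(2)], of \<delta>] \<delta> by linarith
    show ?thesis
      using 1[of x "y - x"] 1[of y "x - y"] that by (cases "x \<le> y") (auto simp: abs_minus_commute)
  qed
  define M where "M = (\<lambda>x. exp (h (max (ln x) X)))"
  show thesis
  proof
    show "M x > 0" for x by (simp add: M_def)
    have "\<forall>\<^sub>F x in at_top. L x > 0" using L by (simp add: slowly_varying_def)
    moreover have "\<forall>\<^sub>F x in at_top. x \<ge> exp X" by (rule eventually_ge_at_top)
    moreover have "\<forall>\<^sub>F x::real in at_top. x > 0" by (rule eventually_gt_at_top)
    ultimately show "\<forall>\<^sub>F x in at_top. M x = L x"
      by eventually_elim (simp add: M_def h_def max_absorb1 ln_ge_iff)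
    fix x y :: real assume xy: "x > 0" "y > 0"
    have "h (max (ln y) X) - h (max (ln x) X) \<le> \<delta> * (\<bar>max (ln y) X - max (ln x) X\<bar> + 1)"
      by (rule abs_le_D1[OF osc]) auto
    also have "\<dots> \<le> \<delta> * (\<bar>ln y - ln x\<bar> + 1)" using \<delta> by (intro mult_left_mono) auto
    finally have "M y \<le> exp (\<delta> * (\<bar>ln y - ln x\<bar> + 1)) * M x"
      by (simp add: M_def flip: exp_add)
    also have "exp (\<delta> * (\<bar>ln y - ln x\<bar> + 1)) = exp \<delta> * exp (\<delta> * \<bar>ln y - ln x\<bar>)"
      by (simp add: exp_add algebra_simps)
    also have "exp (\<delta> * \<bar>ln y - ln x\<bar>) = max (y / x) (x / y) powr \<delta>"
    proof (cases "x \<le> y")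
      case True
      then have "x / y \<le> 1" "1 \<le> y / x" using xy by (auto simp: field_simps)
      then have "max (y / x) (x / y) = y / x" by (simp add: max_absorb1)
      then show ?thesis using xy True by (simp add: powr_def ln_div)
    next
      case False
      then have "y / x \<le> 1" "1 \<le> x / y" using xy by (auto simp: field_simps)
      then have "max (y / x) (x / y) = x / y" by (simp add: max_absorb2)
      then show ?thesis using xy False by (simp add: powr_def ln_div)
    qed
    finally show "M y \<le> exp \<delta> * max (y / x) (x / y) powr \<delta> * M x" .
  qed
qed

subsection \<open>Convolution powers of a distribution with slowly varying tail\<close>

locale prob_seq =
  fixes p :: "nat \<Rightarrow> real"
  assumes p_nonneg: "p m \<ge> 0" and p_sums: "p sums 1"
begin

definition cdf :: "nat \<Rightarrow> real" where "cdf n = (\<Sum>m\<le>n. p m)"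

definition tail :: "nat \<Rightarrow> real" where "tail n = 1 - cdf n"

text \<open>Encoded through a power of the generating series, so that the laws of convolution are
  those of the ring of formal power series.\<close>

definition conv :: "nat \<Rightarrow> nat \<Rightarrow> real" where "conv k n = fps_nth (Abs_fps p ^ k) n"

definition conv_cdf :: "nat \<Rightarrow> nat \<Rightarrow> real" where "conv_cdf k n = (\<Sum>j\<le>n. conv k j)"

lemma cdf_nonneg: "cdf n \<ge> 0"
  by (simp add: cdf_def sum_nonneg p_nonneg)

lemma cdf_mono: "m \<le> n \<Longrightarrow> cdf m \<le> cdf n"
  unfolding cdf_def by (intro sum_mono2) (auto simp: p_nonneg)

lemma cdf_le_1: "cdf n \<le> 1"
  using sum_le_suminf[of p "{..n}"] p_sums p_nonneg by (auto simp: cdf_def sums_iff)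

lemma tail_nonneg: "tail n \<ge> 0" and tail_le_1: "tail n \<le> 1"
  using cdf_nonneg[of n] cdf_le_1[of n] by (auto simp: tail_def)

lemma tail_antimono: "m \<le> n \<Longrightarrow> tail n \<le> tail m"
  using cdf_mono[of m n] by (simp add: tail_def)

lemma tail_diff: "m \<le> n \<Longrightarrow> tail m - tail n = (\<Sum>i\<in>{m<..n}. p i)"
proof -
  assume "m \<le> n"
  then have "{..n} = {..m} \<union> {m<..n}" by auto
  then have "cdf n = cdf m + (\<Sum>i\<in>{m<..n}. p i)"
    unfolding cdf_def by (simp add: sum.union_disjoint ivl_disj_int)
  then show ?thesis by (simp add: tail_def)
qed

lemma tail_tendsto_0: "tail \<longlonglongrightarrow> 0"
proof -
  have "cdf \<longlonglongrightarrow> 1"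
    using p_sums unfolding sums_def_le cdf_def .
  from tendsto_diff[OF tendsto_const this, of 1] show ?thesis
    by (simp add: tail_def[abs_def])
qed

lemma conv_0: "conv 0 n = (if n = 0 then 1 else 0)"
  by (simp add: conv_def)

lemma conv_add: "conv (i + j) n = (\<Sum>m\<le>n. conv i m * conv j (n - m))"
  by (simp add: conv_def power_add fps_mult_nth atLeast0AtMost)

lemma conv_Suc: "conv (Suc k) n = (\<Sum>m\<le>n. p m * conv k (n - m))"
  by (simp add: conv_def fps_mult_nth atLeast0AtMost)

lemma conv_nonneg: "conv k n \<ge> 0"
  by (induction k arbitrary: n) (auto simp: conv_0 conv_Suc intro!: sum_nonneg mult_nonneg_nonneg p_nonneg)

lemma conv_cdf_mono: "m \<le> n \<Longrightarrow> conv_cdf k m \<le> conv_cdf k n"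
  unfolding conv_cdf_def by (intro sum_mono2) (auto simp: conv_nonneg)

text \<open>Exchangeability, \<open>E[S\<^sub>k; S\<^sub>k = n] = k E[X\<^sub>1; S\<^sub>k = n]\<close>, is the derivative of a power.\<close>

lemma conv_size_bias:
  "real n * conv k n = real k * (\<Sum>m\<le>n. real m * p m * conv (k - 1) (n - m))"
proof -
  let ?f = "Abs_fps p"
  have nth: "fps_nth (fps_X * fps_deriv g) m = real m * fps_nth g m" for g :: "real fps" and m
    by (cases m) auto
  define A where "A = fps_X * fps_deriv ?f"
  have A: "fps_nth A m = real m * p m" for m by (simp add: A_def nth)
  have "fps_X * fps_deriv (?f ^ k) = fps_const (real k) * (A * ?f ^ (k - 1))"
    by (simp add: A_def fps_deriv_power algebra_simps)
  then have "real n * fps_nth (?f ^ k) n = fps_nth (fps_const (real k) * (A * ?f ^ (k - 1))) n"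
    using nth[of "?f ^ k" n] by simp
  then show ?thesis
    by (simp add: A conv_def fps_mult_nth[of A] atLeast0AtMost)
qed

lemma conv_cdf_Suc: "conv_cdf (Suc k) n = (\<Sum>m\<le>n. p m * conv_cdf k (n - m))"
proof -
  have "conv_cdf (Suc k) n = (\<Sum>j\<le>n. \<Sum>m\<le>j. p m * conv k (j - m))"
    by (simp add: conv_cdf_def conv_Suc)
  also have "\<dots> = (\<Sum>(m, i)\<in>{(m, i). m + i \<le> n}. p m * conv k i)"
    by (rule sum.triangle_reindex_eq[symmetric])
  also have "{(m, i). m + i \<le> n} = (SIGMA m:{..n}. {..n - m})" by auto
  also have "(\<Sum>(m, i)\<in>\<dots>. p m * conv k i) = (\<Sum>m\<le>n. p m * conv_cdf k (n - m))"
    by (simp add: sum.Sigma[symmetric] conv_cdf_def sum_distrib_left)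
  finally show ?thesis .
qed

text \<open>If a sum of nonnegative integers is at most \<open>n\<close>, so is every summand;
  independence gives the power.\<close>

lemma conv_cdf_le_power: "conv_cdf k n \<le> cdf n ^ k"
proof (induction k)
  case 0
  then show ?case by (simp add: conv_cdf_def conv_0)
next
  case (Suc k)
  have "conv_cdf (Suc k) n \<le> (\<Sum>m\<le>n. p m * cdf n ^ k)"
    unfolding conv_cdf_Suc
    by (intro sum_mono mult_left_mono p_nonneg order.trans[OF conv_cdf_mono Suc]) auto
  then show ?case by (simp add: cdf_def sum_distrib_right)
qed

lemma conv_cdf_le_1: "conv_cdf k n \<le> 1"
  using conv_cdf_le_power[of k n] power_le_one[OF cdf_nonneg cdf_le_1] by (rule order.trans)

lemma conv_le_1: "conv k n \<le> 1"
proof -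
  have "conv k n \<le> conv_cdf k n"
    unfolding conv_cdf_def by (rule member_le_sum) (auto simp: conv_nonneg)
  then show ?thesis using conv_cdf_le_1 by (rule order.trans)
qed

lemma conv_cdf_rev: "(\<Sum>m\<le>n. conv k (n - m)) = conv_cdf k n"
  unfolding conv_cdf_def
  by (rule sum.reindex_bij_witness[of _ "\<lambda>m. n - m" "\<lambda>m. n - m"]) auto

lemma power_cdf_le_exp: "cdf n ^ k \<le> exp (- (real k * tail n))"
proof -
  have "cdf n ^ k \<le> exp (- tail n) ^ k"
    using exp_ge_add_one_self[of "- tail n"] cdf_nonneg by (intro power_mono) (auto simp: tail_def)
  then show ?thesis by (simp add: exp_of_nat_mult[symmetric])
qed

text \<open>A truncated Markov inequality; the offset \<open>n - s\<close> makes the induction on \<open>k\<close> work.\<close>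

lemma conv_cdf_ge:
  assumes "s \<le> n" "n > 0"
  shows "conv_cdf k s \<ge> cdf n ^ k - (real k * (\<Sum>m\<le>n. real m * p m) + (real n - real s)) / real n"
  using assms(1)
proof (induction k arbitrary: s)
  case 0
  have "conv_cdf 0 s = 1" by (simp add: conv_cdf_def conv_0)
  then show ?case using assms 0 by simp
next
  case (Suc k)
  let ?E = "\<Sum>m\<le>n. real m * p m"
  \<comment> \<open>The induction hypothesis at \<open>s - m\<close>. For \<open>m > s\<close> this
    bound is nonpositive, so the sum over \<open>m \<le> s\<close> may be extended to
    \<open>m \<le> n\<close>, where it evaluates to \<open>cdf n\<close> and the truncated
    mean.\<close>
  let ?r = "\<lambda>m. cdf n ^ k - (real k * ?E + (real n - real s + real m)) / real n"
  have E: "?E \<ge> 0" by (intro sum_nonneg) (auto simp: p_nonneg)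
  have "(\<Sum>m\<le>n. p m * ?r m) \<le> (\<Sum>m\<le>s. p m * conv_cdf k (s - m))"
  proof -
    have "?r m \<le> 0" if "s < m" for m
    proof -
      have "1 \<le> (real k * ?E + (real n - real s + real m)) / real n"
        using that assms(2) mult_nonneg_nonneg[OF of_nat_0_le_iff E, of k] by (simp add: field_simps)
      then show ?thesis using power_le_one[OF cdf_nonneg[of n] cdf_le_1, of k] by linarith
    qed
    then have "(\<Sum>m\<in>{s<..n}. p m * ?r m) \<le> 0"
      by (intro sum_nonpos mult_nonneg_nonpos p_nonneg) auto
    moreover have "(\<Sum>m\<le>n. p m * ?r m) = (\<Sum>m\<le>s. p m * ?r m) + (\<Sum>m\<in>{s<..n}. p m * ?r m)"
    proof -
      have "{..n} = {..s} \<union> {s<..n}" using Suc.prems by auto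
      then show ?thesis by (simp add: sum.union_disjoint ivl_disj_int)
    qed
    moreover have "(\<Sum>m\<le>s. p m * ?r m) \<le> (\<Sum>m\<le>s. p m * conv_cdf k (s - m))"
    proof (intro sum_mono mult_left_mono p_nonneg)
      fix m assume "m \<in> {..s}"
      then show "?r m \<le> conv_cdf k (s - m)"
        using Suc.IH[of "s - m"] Suc.prems by (simp add: of_nat_diff algebra_simps)
    qed
    ultimately show ?thesis by linarith
  qed
  moreover have "(\<Sum>m\<le>n. p m * ?r m) =
      cdf n * (cdf n ^ k - (real k * ?E + (real n - real s)) / real n) - ?E / real n"
  proof -
    have "p m * ?r m = p m * (cdf n ^ k - (real k * ?E + (real n - real s)) / real n)
        - real m * p m / real n" for m
      by (simp add: add_divide_distrib diff_divide_distrib algebra_simps)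
    then show ?thesis
      by (simp add: sum_subtractf sum_distrib_right[symmetric] sum_divide_distrib[symmetric] cdf_def)
  qed
  moreover have "cdf n * ((real k * ?E + (real n - real s)) / real n) \<le>
      1 * ((real k * ?E + (real n - real s)) / real n)"
    using E Suc.prems cdf_le_1 by (intro mult_right_mono divide_nonneg_nonneg) auto
  moreover have "(real (Suc k) * ?E + (real n - real s)) / real n =
      (real k * ?E + (real n - real s)) / real n + ?E / real n"
    by (simp add: algebra_simps add_divide_distrib[symmetric])
  ultimately show ?case
    unfolding conv_cdf_Suc power_Suc right_diff_distrib[of "cdf n"] by linarith
qed

text \<open>Of two indices with sum \<open>n\<close> at least one is at least \<open>n / 2\<close>.
  The factor with that index is bounded by its supremum, and the other is summed freely.\<close>

lemma conv_add_le:
  assumes u: "\<And>j. j \<le> n \<Longrightarrow> n \<le> 2 * j \<Longrightarrow> conv k j \<le> u"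
    and u': "\<And>j. j \<le> n \<Longrightarrow> n \<le> 2 * j \<Longrightarrow> conv l j \<le> u'"
  shows "conv (k + l) n \<le> u * conv_cdf l n + u' * conv_cdf k n"
proof -
  have nn: "u \<ge> 0" "u' \<ge> 0"
    using u[of n] u'[of n] conv_nonneg[of k n] conv_nonneg[of l n] by auto
  have "conv k m * conv l (n - m) \<le> u * conv l (n - m) + u' * conv k m" if "m \<le> n" for m
  proof (cases "n \<le> 2 * m")
    case True
    then have "conv k m * conv l (n - m) \<le> u * conv l (n - m)"
      using u[of m] that by (intro mult_right_mono conv_nonneg)
    then show ?thesis using nn conv_nonneg[of k m] by (simp add: add_increasing2)
  next
    case False
    then have "conv l (n - m) * conv k m \<le> u' * conv k m"
      using u'[of "n - m"] that by (intro mult_right_mono conv_nonneg) auto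
    then show ?thesis using nn conv_nonneg[of l "n - m"] by (simp add: add_increasing mult.commute)
  qed
  then have "conv (k + l) n \<le> (\<Sum>m\<le>n. u * conv l (n - m) + u' * conv k m)"
    unfolding conv_add by (intro sum_mono) auto
  also have "\<dots> = u * (\<Sum>m\<le>n. conv l (n - m)) + u' * conv_cdf k n"
    by (simp add: sum.distrib sum_distrib_left conv_cdf_def)
  also have "(\<Sum>m\<le>n. conv l (n - m)) = conv_cdf l n" by (rule conv_cdf_rev)
  finally show ?thesis .
qed

end

text \<open>\<open>M\<close> is a positive stand-in for the slowly varying \<open>n * p n\<close>;
  the lower comparison holds only eventually because \<open>p\<close> may vanish at small indices.
  \<open>M_comparable\<close> and \<open>M_sum\<close> are Potter and Karamata type estimates up to
  the factor \<open>C\<close>, \<open>M_tail\<close> says that \<open>n * p n\<close> is negligible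
  against the tail, and the sharp constant in the local limit rests on
  \<open>p_uniform\<close>.\<close>

locale slow_density = prob_seq +
  fixes M :: "nat \<Rightarrow> real" and C :: real
  assumes M_pos: "M n > 0" and C_ge_1: "C \<ge> 1"
    and p_le: "n \<ge> 1 \<Longrightarrow> real n * p n \<le> C * M n"
    and p_ge: "\<forall>\<^sub>F n in sequentially. M n \<le> C * (real n * p n)"
    and M_comparable: "1 \<le> m \<Longrightarrow> m \<le> n \<Longrightarrow> n \<le> 2 * m \<Longrightarrow> M m \<le> C * M n"
    and M_sum: "n \<ge> 1 \<Longrightarrow> (\<Sum>m=1..n. M m) \<le> C * real n * M n"
    and M_tail: "(\<lambda>n. M n / tail n) \<longlonglongrightarrow> 0"
    and p_uniform: "\<epsilon> > 0 \<Longrightarrow> \<forall>\<^sub>F n in sequentially. \<forall>m\<le>n. n \<le> 2 * m \<longrightarrow>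
           \<bar>real m * p m - real n * p n\<bar> \<le> \<epsilon> * (real n * p n)"
begin

text \<open>Positivity of \<open>M\<close> and the lower bound \<open>p_ge\<close> keep
  \<open>p\<close> from vanishing at large indices, so mass remains beyond every
  \<open>n\<close>.\<close>

lemma tail_pos: "tail n > 0"
proof -
  obtain N where N: "\<And>m. m \<ge> N \<Longrightarrow> M m \<le> C * (real m * p m)"
    using p_ge by (auto simp: eventually_sequentially)
  define m where "m = Suc (max n N)"
  have "p m > 0"
  proof (rule ccontr)
    assume "\<not> p m > 0"
    then have "p m = 0" using p_nonneg[of m] by simp
    moreover have "m \<ge> N" by (simp add: m_def)
    ultimately show False using N[of m] M_pos[of m] by simp
  qed
  also have "p m \<le> (\<Sum>i\<in>{n<..m}. p i)"
    by (rule member_le_sum) (auto simp: m_def p_nonneg)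
  also have "\<dots> = tail n - tail m" by (simp add: tail_diff m_def)
  also have "\<dots> \<le> tail n" using tail_nonneg by simp
  finally show ?thesis .
qed

lemma M_div_comparable:
  assumes "1 \<le> m" "m \<le> n" "n \<le> 2 * m"
  shows "M m / real m \<le> 2 * C * (M n / real n)"
proof -
  have "M m / real m \<le> (C * M n) / (real n / 2)"
    using assms M_comparable[OF assms] M_pos[of m] by (intro frac_le) auto
  then show ?thesis by (simp add: mult_ac)
qed

lemma size_bias_sum_le: "n \<ge> 1 \<Longrightarrow> (\<Sum>m\<le>n. real m * p m) \<le> C\<^sup>2 * real n * M n"
proof -
  assume n: "n \<ge> 1"
  have "(\<Sum>m\<le>n. real m * p m) = (\<Sum>m=1..n. real m * p m)"
    by (rule sum.mono_neutral_right) auto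
  also have "\<dots> \<le> (\<Sum>m=1..n. C * M m)" by (intro sum_mono p_le) auto
  also have "\<dots> \<le> C * (C * real n * M n)"
    unfolding sum_distrib_left[symmetric] using M_sum[OF n] C_ge_1 by (intro mult_left_mono) auto
  finally show ?thesis by (simp add: power2_eq_square algebra_simps)
qed

text \<open>Splitting \<open>k\<close> in half improves a linear bound by an exponential factor: one half carries the
  sum above \<open>n / 2\<close> while the other half stays below \<open>n\<close>.\<close>

lemma conv_exp_le:
  assumes B: "B \<ge> 0" and n: "n \<ge> 1"
    and lin: "\<And>l j. l \<le> k \<Longrightarrow> j \<ge> 1 \<Longrightarrow> conv l j \<le> B * real l * (M j / real j)"
  shows "conv k n \<le> 4 * C * B * real k * (M n / real n) * exp (- (real k * tail n / 2))"
proof -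
  define k1 k2 where "k1 = k div 2" and "k2 = k - k div 2"
  have k: "k = k1 + k2" "k1 \<le> k" "k2 \<le> k" "real k - 1 \<le> 2 * real k1" "real k1 \<le> real k2"
    by (auto simp: k1_def k2_def)
  have u: "conv l j \<le> B * real l * (2 * C * (M n / real n))"
    if "l \<le> k" "j \<le> n" "n \<le> 2 * j" for l j
  proof -
    have "j \<ge> 1" using that n by auto
    then have "conv l j \<le> B * real l * (M j / real j)" using lin that by auto
    also have "\<dots> \<le> B * real l * (2 * C * (M n / real n))"
      using M_div_comparable[OF \<open>j \<ge> 1\<close>] that B by (intro mult_left_mono) auto
    finally show ?thesis .
  qed
  \<comment> \<open>Each half has at least \<open>(k - 1) / 2\<close> summands. Rounding costs at
    most \<open>exp (1 / 2) \<le> 2\<close> because \<open>tail n \<le> 1\<close>; with the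
    \<open>2 * C\<close> from \<open>M_div_comparable\<close> this makes the constant
    \<open>4 * C\<close>.\<close>
  have e: "conv_cdf l n \<le> 2 * exp (- (real k * tail n / 2))" if "real k - 1 \<le> 2 * real l" for l
  proof -
    have "conv_cdf l n \<le> exp (- (real l * tail n))"
      using conv_cdf_le_power power_cdf_le_exp by (rule order.trans)
    also have "\<dots> \<le> exp (1 / 2 - real k * tail n / 2)"
    proof -
      have "(real k - 1) * tail n \<le> 2 * real l * tail n"
        using that tail_nonneg by (intro mult_right_mono) auto
      then show ?thesis using tail_le_1[of n] by (simp add: algebra_simps)
    qed
    also have "\<dots> = exp (1 / 2) * exp (- (real k * tail n / 2))"
      by (simp flip: exp_add)
    also have "exp (1 / 2 :: real) \<le> 2"
      using exp_half_le2 by simp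
    finally show ?thesis by simp
  qed
  define g where "g = 2 * C * (M n / real n)"
  have g: "g \<ge> 0" using C_ge_1 M_pos[of n] by (simp add: g_def)
  have "conv k n \<le> B * real k1 * g * conv_cdf k2 n + B * real k2 * g * conv_cdf k1 n"
    unfolding k(1) g_def using u k by (intro conv_add_le) auto
  also have "\<dots> \<le> B * real k1 * g * (2 * exp (- (real k * tail n / 2)))
      + B * real k2 * g * (2 * exp (- (real k * tail n / 2)))"
    using B g k by (intro add_mono mult_left_mono e) auto
  also have "\<dots> = B * (real k1 + real k2) * g * (2 * exp (- (real k * tail n / 2)))"
    by (simp add: algebra_simps)
  also have "real k1 + real k2 = real k" using k(1) by simp
  finally show ?thesis by (simp add: g_def mult_ac)
qed

text \<open>Strong induction on \<open>k\<close> with a fixed \<open>B\<close>: the indices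
  \<open>m \<ge> n / 2\<close> contribute at most \<open>C\<^sup>2 * M n\<close> with no
  \<open>B\<close> in it, and the others contribute \<open>B * M n\<close> times a multiple of
  \<open>M n / tail n\<close>. Each is made at most \<open>B * M n / 2\<close>.\<close>

lemma conv_linear_bound:
  obtains B where "B \<ge> 0" "\<And>k n. n \<ge> 1 \<Longrightarrow> conv k n \<le> B * real k * (M n / real n)"
proof -
  have C0: "C > 0" using C_ge_1 by simp
  \<comment> \<open>The product of \<open>8 * C\<^sup>2\<close> in \<open>r\<close> and
    \<open>C\<^sup>2\<close> in \<open>size_bias_sum_le\<close>.\<close>
  define D where "D = 8 * C ^ 4"
  have D: "D > 0" using C0 by (simp add: D_def)
  have "\<forall>\<^sub>F n in sequentially. M n / tail n < 1 / (2 * D)"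
    using D by (intro order_tendstoD(2)[OF M_tail]) auto
  then obtain n0 where n0: "\<And>n. n \<ge> n0 \<Longrightarrow> M n / tail n < 1 / (2 * D)"
    unfolding eventually_sequentially by blast
  \<comment> \<open>The first summand gives \<open>C\<^sup>2 \<le> B / 2\<close>. The second settles
    the finitely many \<open>n < n0\<close>, where \<open>M n / tail n\<close> may be large, by the
    trivial bound \<open>conv k n \<le> 1\<close>.\<close>
  define B where "B = 2 * C\<^sup>2 + (\<Sum>n=1..n0. real n / M n)"
  have sum_nn: "(\<Sum>n=1..n0. real n / M n) \<ge> 0"
    by (intro sum_nonneg) (auto intro!: divide_nonneg_nonneg less_imp_le[OF M_pos])
  have B: "B \<ge> 2 * C\<^sup>2" "B \<ge> 0" using sum_nn by (auto simp: B_def)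
  have "conv k n \<le> B * real k * (M n / real n)" if "n \<ge> 1" for k n
    using that
  proof (induction k arbitrary: n rule: less_induct)
    case (less k')
    show ?case
    proof (cases k')
      case 0
      then show ?thesis using less.prems by (simp add: conv_0)
    next
      case (Suc k)
      have IH: "conv l j \<le> B * real l * (M j / real j)" if "l \<le> k" "j \<ge> 1" for l j
        using less.IH[of l j] that Suc by auto
      show ?thesis
      proof (cases "n < n0")
        case True
        have "real n / M n \<le> (\<Sum>n=1..n0. real n / M n)"
          using less.prems True by (intro member_le_sum) (auto intro!: divide_nonneg_nonneg less_imp_le[OF M_pos])
        then have "real n / M n \<le> B" by (simp add: B_def add_increasing)
        then have "1 \<le> B * (M n / real n)"
          using M_pos[of n] less.prems by (simp add: field_simps)
        also have "\<dots> \<le> B * (M n / real n) * real k'"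
          using mult_left_mono[of 1 "real k'" "B * (M n / real n)"] M_pos[of n] B Suc by simp
        finally show ?thesis using conv_le_1[of k' n] by (simp add: mult_ac)
      next
        case False
        \<comment> \<open>A bound for \<open>conv k (n - m)\<close> when \<open>m < n / 2\<close>
          that no longer depends on \<open>k\<close>: it comes from \<open>conv_exp_le\<close> after
          \<open>k * tail n\<close> has been absorbed by the exponential.\<close>
        define r where "r = 8 * C\<^sup>2 * B * (M n / real n) / tail n"
        have r: "r \<ge> 0" using B M_pos[of n] tail_nonneg by (simp add: r_def)
        have termwise: "real m * p m * conv k (n - m) \<le> C\<^sup>2 * M n * conv k (n - m) + r * (real m * p m)"
          if m: "m \<le> n" for m
        proof (cases "n \<le> 2 * m")
          case True
          then have m1: "m \<ge> 1" using less.prems by auto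
          have "real m * p m \<le> C * (C * M n)"
            using p_le[OF m1] M_comparable[OF m1 m True] C0 by (smt (verit) mult_left_mono)
          then have "real m * p m * conv k (n - m) \<le> C * (C * M n) * conv k (n - m)"
            by (intro mult_right_mono conv_nonneg)
          moreover have "r * (real m * p m) \<ge> 0" using r p_nonneg by simp
          ultimately show ?thesis by (simp add: power2_eq_square mult_ac)
        next
          case False
          define j where "j = n - m"
          have j: "1 \<le> j" "j \<le> n" "n \<le> 2 * j" using False m by (auto simp: j_def)
          have "conv k j \<le> 4 * C * B * real k * (M j / real j) * exp (- (real k * tail j / 2))"
            using B j IH by (intro conv_exp_le) auto
          also have "\<dots> \<le> 4 * C * B * real k * (2 * C * (M n / real n)) * exp (- (real k * tail n / 2))"
            using B C0 M_pos j tail_antimono[OF j(2)] M_pos[THEN less_imp_le]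
            by (intro mult_mono M_div_comparable) (auto intro!: mult_left_mono)
          also have "\<dots> = r * (real k * tail n * exp (- (real k * tail n / 2)))"
            using tail_pos[of n] by (simp add: r_def power2_eq_square)
          also have "\<dots> \<le> r * 1"
          proof -
            \<comment> \<open>Square \<open>1 + x / 4 \<le> exp (x / 4)\<close>; the left side
              dominates \<open>x\<close> since \<open>(x / 4 - 1)\<^sup>2 \<ge> 0\<close>.\<close>
            have "x * exp (- (x / 2)) \<le> 1" if "x \<ge> 0" for x :: real
            proof -
              have "x \<le> (1 + x / 4)\<^sup>2" by (simp add: power2_eq_square algebra_simps)
                (use zero_le_power2[of "x / 4 - 1"] in \<open>simp add: power2_eq_square algebra_simps\<close>)
              also have "\<dots> \<le> exp (x / 4) ^ 2" using that by (intro power_mono) auto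
              also have "\<dots> = exp (x / 2)" by (simp flip: exp_double)
              finally show ?thesis by (simp add: exp_minus field_simps)
            qed
            then show ?thesis using r tail_nonneg[of n] by (intro mult_left_mono) auto
          qed
          finally have "real m * p m * conv k j \<le> real m * p m * r"
            by (intro mult_left_mono) (auto simp: p_nonneg)
          moreover have "C\<^sup>2 * M n * conv k j \<ge> 0"
            using M_pos[of n] conv_nonneg by simp
          ultimately show ?thesis by (simp add: j_def mult_ac)
        qed
        have "(\<Sum>m\<le>n. real m * p m * conv k (n - m)) \<le>
            (\<Sum>m\<le>n. C\<^sup>2 * M n * conv k (n - m) + r * (real m * p m))"
          by (intro sum_mono termwise) auto
        also have "\<dots> = C\<^sup>2 * M n * conv_cdf k n + r * (\<Sum>m\<le>n. real m * p m)"
          by (simp add: sum.distrib sum_distrib_left[symmetric] conv_cdf_rev)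
        also have "\<dots> \<le> C\<^sup>2 * M n * 1 + r * (C\<^sup>2 * real n * M n)"
          using r M_pos[of n] less.prems
          by (intro add_mono mult_left_mono conv_cdf_le_1 size_bias_sum_le) auto
        also have "\<dots> = M n * (C\<^sup>2 + B * (D * (M n / tail n)))"
          using less.prems by (simp add: r_def D_def field_simps power2_eq_square power4_eq_xxxx)
        also have "\<dots> \<le> M n * (B / 2 + B * (1 / 2))"
        proof -
          have "D * (M n / tail n) \<le> D * (1 / (2 * D))"
            using n0[of n] False D by (intro mult_left_mono) auto
          then show ?thesis
            using D B M_pos[of n] by (intro mult_left_mono add_mono) auto
        qed
        also have "\<dots> = B * M n" by simp
        finally have "real n * conv k' n \<le> real k' * (B * M n)"
          unfolding conv_size_bias[of n k'] by (simp add: Suc mult_left_mono del: of_nat_Suc)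
        then show ?thesis using less.prems by (simp add: field_simps)
      qed
    qed
  qed
  then show thesis using that B by blast
qed

end

subsection \<open>The local limit in the window \<open>k \<asymp> 1 / T(n)\<close>\<close>

context slow_density
begin

text \<open>A filter on pairs \<open>(n, k)\<close>: convergence along it is convergence in
  \<open>n\<close>, uniform over all \<open>k\<close> with \<open>k * tail n\<close> in the
  interval. Uniform statements thereby obey the ordinary limit rules.\<close>

definition window :: "real \<Rightarrow> real \<Rightarrow> (nat \<times> nat) filter" where
  "window a b = inf (filtercomap fst sequentially) (principal {(n, k). real k * tail n \<in> {a..b}})"

lemma eventually_window:
  "eventually P (window a b) \<longleftrightarrow>
     (\<forall>\<^sub>F n in sequentially. \<forall>k. real k * tail n \<in> {a..b} \<longrightarrow> P (n, k))"
proof -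
  have "(\<exists>Q. eventually Q sequentially \<and>
          (\<forall>x. Q (fst x) \<longrightarrow> x \<in> {(n, k). real k * tail n \<in> {a..b}} \<longrightarrow> P x)) \<longleftrightarrow>
        (\<forall>\<^sub>F n in sequentially. \<forall>k. real k * tail n \<in> {a..b} \<longrightarrow> P (n, k))"
    by (auto elim!: eventually_mono)
  then show ?thesis
    by (simp add: window_def eventually_inf_principal eventually_filtercomap)
qed

lemma window_fst: "filterlim fst sequentially (window a b)"
  unfolding window_def using filterlim_filtercomap filterlim_mono inf_le1 order_refl by metis

lemma window_mem: "\<forall>\<^sub>F (n, k) in window a b. real k * tail n \<in> {a..b}"
  by (simp add: eventually_window)

lemma window_tendsto:
  assumes "f \<longlonglongrightarrow> l"
  shows "((\<lambda>(n, k). f n) \<longlongrightarrow> l) (window a b)"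
  using filterlim_compose[OF assms window_fst] by (simp add: case_prod_unfold)

text \<open>As \<open>tail n\<close> vanishes, a positive lower bound on \<open>k * tail n\<close>
  forces \<open>k\<close> to infinity; this is where the window must stay away from 0.\<close>

lemma window_snd:
  assumes "a > 0"
  shows "filterlim snd sequentially (window a b)"
  unfolding filterlim_at_top
proof
  fix K :: nat
  have "\<forall>\<^sub>F n in sequentially. tail n < a / (real K + 1)"
    using assms by (intro order_tendstoD(2)[OF tail_tendsto_0]) auto
  then show "\<forall>\<^sub>F x in window a b. K \<le> snd x"
    unfolding eventually_window
  proof eventually_elim
    case (elim n)
    show ?case
    proof (intro allI impI)
      fix k assume k: "real k * tail n \<in> {a..b}"
      have "real k * tail n \<le> real k * (a / (real K + 1))"
        using elim by (intro mult_left_mono) auto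
      then have "a * 1 \<le> a * (real k / (real K + 1))" using k by (simp add: mult.commute)
      then have "1 \<le> real k / (real K + 1)" using assms by (rule mult_left_le_imp_le)
      then show "K \<le> snd (n, k)" by (simp add: field_simps)
    qed
  qed
qed

text \<open>On the window \<open>k\<close> is at most of order \<open>1 / tail n\<close>, so
  whatever is negligible against the tail remains negligible after multiplication by
  \<open>k\<close>.\<close>

lemma window_null:
  assumes f: "(\<lambda>n. f n / tail n) \<longlonglongrightarrow> 0"
  shows "((\<lambda>(n, k). real k * f n) \<longlongrightarrow> 0) (window a b)"
proof (rule Lim_null_comparison)
  show "((\<lambda>(n, k). \<bar>b\<bar> * \<bar>f n / tail n\<bar>) \<longlongrightarrow> 0) (window a b)"
    using tendsto_mult[OF tendsto_const tendsto_rabs[OF f], of "\<bar>b\<bar>"] by (intro window_tendsto) simp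
  show "\<forall>\<^sub>F x in window a b. norm (case x of (n, k) \<Rightarrow> real k * f n) \<le> (case x of (n, k) \<Rightarrow> \<bar>b\<bar> * \<bar>f n / tail n\<bar>)"
    using window_mem
  proof eventually_elim
    case (elim x)
    obtain n k where x: "x = (n, k)" by force
    have "\<bar>real k * f n\<bar> = \<bar>real k * tail n\<bar> * \<bar>f n / tail n\<bar>"
      using tail_pos[of n] by (simp add: abs_mult)
    also have "\<bar>real k * tail n\<bar> \<le> \<bar>b\<bar>"
      using elim tail_pos[of n] by (auto simp: x abs_mult)
    finally show ?case by (simp only: x mult_right_mono abs_ge_zero real_norm_def prod.case)
  qed
qed

text \<open>The block between \<open>n / 2\<close> and \<open>n\<close> has at most \<open>n\<close>
  terms, each at most of order \<open>M n / n\<close>. With \<open>M_tail\<close>, halving the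
  argument changes the tail by a negligible amount.\<close>

lemma tail_half_le: "tail (n div 2) - tail n \<le> 2 * C\<^sup>2 * M n"
proof -
  have "(\<Sum>i\<in>{n div 2<..n}. p i) \<le> (\<Sum>i\<in>{n div 2<..n}. 2 * C\<^sup>2 * (M n / real n))"
  proof (rule sum_mono)
    fix i assume i: "i \<in> {n div 2<..n}"
    then have i': "1 \<le> i" "i \<le> n" "n \<le> 2 * i" by auto
    have "p i \<le> C * (M i / real i)"
      using p_le[OF i'(1)] i' by (simp add: field_simps)
    also have "\<dots> \<le> C * (2 * C * (M n / real n))"
      using C_ge_1 by (intro mult_left_mono M_div_comparable i') auto
    finally show "p i \<le> 2 * C\<^sup>2 * (M n / real n)" by (simp add: power2_eq_square mult_ac)
  qed
  also have "\<dots> = real (n - n div 2) * (2 * C\<^sup>2 * (M n / real n))" by simp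
  also have "\<dots> \<le> real n * (2 * C\<^sup>2 * (M n / real n))"
    using M_pos[of n] by (intro mult_right_mono) auto
  also have "\<dots> \<le> 2 * C\<^sup>2 * M n" using M_pos[of n] by (cases "n = 0") auto
  finally show ?thesis by (simp add: tail_diff)
qed

lemma M_half_le:
  assumes "n \<ge> 2"
  shows "M (n div 2) \<le> C\<^sup>2 * M n"
proof -
  have "M (n div 2) \<le> C * M (n div 2 + 1)" by (intro M_comparable) (use assms in auto)
  also have "\<dots> \<le> C * (C * M n)"
    using C_ge_1 by (intro mult_left_mono M_comparable) (use assms in auto)
  finally show ?thesis by (simp add: power2_eq_square)
qed

text \<open>Expand \<open>(k - 1) * ln (1 - t n)\<close> with \<open>t n\<close> the tail at
  \<open>n / 2\<close>. Its distance from \<open>- k * tail n\<close> has three parts, all vanishing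
  on the window: \<open>k * e n\<close> from moving the tail from \<open>n / 2\<close> to
  \<open>n\<close>, a single \<open>t n\<close> from \<open>k - 1\<close> in place of
  \<open>k\<close>, and \<open>2 * k * (t n)\<^sup>2\<close> from the second order of the
  logarithm.\<close>

lemma window_power_cdf:
  assumes "a > 0"
  shows "((\<lambda>(n, k). exp (real k * tail n) * cdf (n div 2) ^ (k - 1)) \<longlongrightarrow> 1) (window a b)"
proof -
  define t where "t = (\<lambda>n. tail (n div 2))"
  define e where "e = (\<lambda>n. t n - tail n)"
  have e_le: "0 \<le> e n" "e n \<le> 2 * C\<^sup>2 * M n" for n
    using tail_half_le[of n] tail_antimono[of "n div 2" n] by (auto simp: e_def t_def)
  have e_tail: "(\<lambda>n. e n / tail n) \<longlonglongrightarrow> 0"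
  proof (rule Lim_null_comparison)
    show "(\<lambda>n. 2 * C\<^sup>2 * (M n / tail n)) \<longlonglongrightarrow> 0"
      using tendsto_mult[OF tendsto_const M_tail] by simp
    show "\<forall>\<^sub>F n in sequentially. norm (e n / tail n) \<le> 2 * C\<^sup>2 * (M n / tail n)"
      using e_le tail_pos by (intro always_eventually) (auto simp: divide_right_mono less_imp_le)
  qed
  have t_lim: "t \<longlonglongrightarrow> 0"
    unfolding t_def by (rule filterlim_compose[OF tail_tendsto_0]) (simp add: filterlim_at_top_div_const_nat)
  have t2: "(\<lambda>n. (2 * (t n)\<^sup>2) / tail n) \<longlonglongrightarrow> 0"
  proof -
    have "(\<lambda>n. 2 * ((1 + e n / tail n) * t n)) \<longlonglongrightarrow> 2 * ((1 + 0) * 0)"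
      by (intro tendsto_intros e_tail t_lim)
    moreover have "2 * ((1 + e n / tail n) * t n) = (2 * (t n)\<^sup>2) / tail n" for n
      using tail_pos[of n] by (simp add: e_def field_simps power2_eq_square)
    ultimately show ?thesis by simp
  qed
  have lim0: "((\<lambda>(n, k). real k * tail n + real (k - 1) * ln (1 - t n)) \<longlongrightarrow> 0) (window a b)"
  proof (rule Lim_null_comparison)
    have "((\<lambda>x. (case x of (n, k) \<Rightarrow> real k * e n) + (case x of (n, k) \<Rightarrow> t n)
        + (case x of (n, k) \<Rightarrow> real k * (2 * (t n)\<^sup>2))) \<longlongrightarrow> 0 + 0 + 0) (window a b)"
      by (intro tendsto_add window_null window_tendsto e_tail t_lim t2)
    then show "((\<lambda>(n, k). real k * e n + t n + real k * (2 * (t n)\<^sup>2)) \<longlongrightarrow> 0) (window a b)"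
      by (simp add: case_prod_unfold)
    have "\<forall>\<^sub>F x in window a b. t (fst x) < 1 / 2"
      using order_tendstoD(2)[OF window_tendsto[OF t_lim], of "1 / 2"] by (simp add: case_prod_unfold)
    moreover have "\<forall>\<^sub>F x in window a b. snd x \<ge> 1"
      using window_snd[OF assms] unfolding filterlim_at_top by blast
    ultimately show "\<forall>\<^sub>F x in window a b.
        norm (case x of (n, k) \<Rightarrow> real k * tail n + real (k - 1) * ln (1 - t n))
        \<le> (case x of (n, k) \<Rightarrow> real k * e n + t n + real k * (2 * (t n)\<^sup>2))"
    proof eventually_elim
      case (elim x)
      obtain n k where x: "x = (n, k)" by force
      have tn: "0 \<le> t n" "t n < 1 / 2" and k: "k \<ge> 1"
        using elim tail_nonneg by (auto simp: x t_def)
      define d where "d = ln (1 - t n) + t n"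
      have "\<bar>d\<bar> \<le> 2 * (t n)\<^sup>2"
        using abs_ln_one_plus_x_minus_x_bound[of "- t n"] tn by (simp add: d_def)
      then have "\<bar>real (k - 1) * d\<bar> \<le> real k * (2 * (t n)\<^sup>2)"
        unfolding abs_mult by (intro mult_mono) auto
      moreover have "real k * tail n + real (k - 1) * ln (1 - t n) =
          - (real k * e n) + t n + real (k - 1) * d"
        using k by (simp add: e_def d_def of_nat_diff algebra_simps)
      moreover have "real k * e n \<ge> 0" using e_le by simp
      ultimately show ?case using tn by (simp add: x)
    qed
  qed
  have "((\<lambda>x. exp (case x of (n, k) \<Rightarrow> real k * tail n + real (k - 1) * ln (1 - t n))) \<longlongrightarrow> exp 0) (window a b)"
    by (intro tendsto_exp lim0)
  moreover have "\<forall>\<^sub>F x in window a b. exp (case x of (n, k) \<Rightarrow> real k * tail n + real (k - 1) * ln (1 - t n)) =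
      (case x of (n, k) \<Rightarrow> exp (real k * tail n) * cdf (n div 2) ^ (k - 1))"
  proof -
    have "\<forall>\<^sub>F x in window a b. t (fst x) < 1 / 2"
      using order_tendstoD(2)[OF window_tendsto[OF t_lim], of "1 / 2"] by (simp add: case_prod_unfold)
    then show ?thesis
    proof eventually_elim
      case (elim x)
      obtain n k where x: "x = (n, k)" by force
      have "1 - t n = cdf (n div 2)" by (simp add: t_def tail_def)
      moreover have "1 - t n > 0" using elim by (simp add: x)
      ultimately show ?case by (simp add: x exp_add exp_of_nat_mult)
    qed
  qed
  ultimately show ?thesis
    using Lim_transform_eventually by fastforce
qed

text \<open>Valid for all \<open>k \<ge> 1\<close> at once. Replacing \<open>m * p m\<close> by
  \<open>n * p n\<close> in the upper half of the size-bias sum costs \<open>\<epsilon>\<close>; the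
  lower half costs \<open>D * k * M n\<close>, small only on a window. \<open>D\<close> is fixed
  before \<open>\<epsilon>\<close>, so the two errors can be made small independently.\<close>

lemma conv_ratio_approx:
  obtains D where "D \<ge> 0"
    and "\<And>\<epsilon>. \<epsilon> > 0 \<Longrightarrow> \<forall>\<^sub>F n in sequentially. \<forall>k\<ge>1.
           \<bar>conv k n / (real k * p n) - conv_cdf (k - 1) (n div 2)\<bar> \<le> \<epsilon> + D * (real k * M n)"
proof -
  obtain B where B: "B \<ge> 0" "\<And>k n. n \<ge> 1 \<Longrightarrow> conv k n \<le> B * real k * (M n / real n)"
    using conv_linear_bound by blast
  \<comment> \<open>The linear bound at \<open>n - m\<close> gives \<open>2 * B * C\<close>, the
    truncated mean \<open>C\<^sup>2\<close>, and the last \<open>C\<close> trades one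
    \<open>M n\<close> for \<open>n * p n\<close>.\<close>
  define D where "D = 2 * B * C ^ 4"
  have D: "D \<ge> 0" using B by (simp add: D_def)
  have "\<forall>\<^sub>F n in sequentially. \<forall>k\<ge>1.
      \<bar>conv k n / (real k * p n) - conv_cdf (k - 1) (n div 2)\<bar> \<le> \<epsilon> + D * (real k * M n)"
    if \<epsilon>: "\<epsilon> > 0" for \<epsilon>
    using p_uniform[OF \<epsilon>] p_ge eventually_ge_at_top[of 1]
  proof eventually_elim
    case (elim n)
    define P where "P = real n * p n"
    have P: "M n \<le> C * P" "P > 0"
    proof -
      show *: "M n \<le> C * P" using elim by (simp add: P_def)
      show "P > 0" using M_pos[of n] C_ge_1 * by (smt (verit) mult_nonneg_nonpos)
    qed
    show ?case
    proof (intro allI impI)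
      fix k :: nat assume k: "k \<ge> 1"
      define q where "q = conv (k - 1)"
      define H where "H = {m. m \<le> n \<and> n \<le> 2 * m}"
      define H' where "H' = {m. m \<le> n \<and> \<not> n \<le> 2 * m}"
      have fin: "finite H" "finite H'" by (auto simp: H_def H'_def)
      have HH: "{..n} = H \<union> H'" "H \<inter> H' = {}" by (auto simp: H_def H'_def)
      \<comment> \<open>Under \<open>m \<mapsto> n - m\<close> the condition
        \<open>n \<le> 2 * m\<close> becomes exactly \<open>n - m \<le> n div 2\<close>, for either
        parity of \<open>n\<close>.\<close>
      have cdfH: "(\<Sum>m\<in>H. q (n - m)) = conv_cdf (k - 1) (n div 2)"
        unfolding conv_cdf_def q_def
        by (rule sum.reindex_bij_witness[of _ "\<lambda>m. n - m" "\<lambda>m. n - m"]) (auto simp: H_def)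
      have q0: "q j \<ge> 0" for j by (simp add: q_def conv_nonneg)
      define S1 where "S1 = (\<Sum>m\<in>H. real m * p m * q (n - m))"
      define S2 where "S2 = (\<Sum>m\<in>H'. real m * p m * q (n - m))"
      have "real n * conv k n = real k * (S1 + S2)"
        unfolding conv_size_bias HH(1) sum.union_disjoint[OF fin HH(2)] S1_def S2_def q_def ..
      then have eq: "conv k n / (real k * p n) = (S1 + S2) / P"
      proof -
        have "conv k n / (real k * p n) = (real n * conv k n) / (real k * P)"
          using elim(3) by (simp add: P_def)
        also have "\<dots> = (S1 + S2) / P"
          using k by (simp add: \<open>real n * conv k n = real k * (S1 + S2)\<close>)
        finally show ?thesis .
      qed
      have "\<bar>S1 - P * (\<Sum>m\<in>H. q (n - m))\<bar> = \<bar>\<Sum>m\<in>H. (real m * p m - P) * q (n - m)\<bar>"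
        by (simp add: S1_def sum_distrib_left left_diff_distrib sum_subtractf)
      also have "\<dots> \<le> (\<Sum>m\<in>H. \<bar>(real m * p m - P) * q (n - m)\<bar>)" by (rule sum_abs)
      also have "\<dots> \<le> (\<Sum>m\<in>H. \<epsilon> * P * q (n - m))"
        using elim(1) q0 by (intro sum_mono) (auto simp: abs_mult P_def H_def intro!: mult_right_mono)
      also have "\<dots> = \<epsilon> * P * conv_cdf (k - 1) (n div 2)"
        unfolding sum_distrib_left[symmetric] cdfH ..
      also have "\<dots> \<le> \<epsilon> * P * 1"
        using \<epsilon> P by (intro mult_left_mono conv_cdf_le_1) auto
      finally have 1: "\<bar>S1 - P * conv_cdf (k - 1) (n div 2)\<bar> \<le> \<epsilon> * P"
        by (simp add: cdfH)
      have S2_nn: "0 \<le> S2" unfolding S2_def by (intro sum_nonneg mult_nonneg_nonneg q0) (auto simp: p_nonneg)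
      have "S2 \<le> (\<Sum>m\<in>H'. real m * p m * (B * real k * (2 * C * (M n / real n))))"
        unfolding S2_def
      proof (intro sum_mono mult_left_mono)
        fix m assume "m \<in> H'"
        then have j: "1 \<le> n - m" "n - m \<le> n" "n \<le> 2 * (n - m)" by (auto simp: H'_def)
        have "q (n - m) \<le> B * real (k - 1) * (M (n - m) / real (n - m))"
          unfolding q_def using B j by blast
        also have "\<dots> \<le> B * real k * (2 * C * (M n / real n))"
          using B M_pos[of "n - m"] by (intro mult_mono M_div_comparable j) auto
        finally show "q (n - m) \<le> B * real k * (2 * C * (M n / real n))" .
      qed (auto simp: p_nonneg)
      also have "\<dots> = (\<Sum>m\<in>H'. real m * p m) * (B * real k * (2 * C * (M n / real n)))"
        by (rule sum_distrib_right[symmetric])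
      also have "\<dots> \<le> (C\<^sup>2 * real n * M n) * (B * real k * (2 * C * (M n / real n)))"
      proof (intro mult_right_mono)
        have "(\<Sum>m\<in>H'. real m * p m) \<le> (\<Sum>m\<le>n. real m * p m)"
          by (intro sum_mono2) (auto simp: p_nonneg H'_def)
        then show "(\<Sum>m\<in>H'. real m * p m) \<le> C\<^sup>2 * real n * M n"
          using size_bias_sum_le[OF elim(3)] by linarith
      qed (use B C_ge_1 M_pos[of n] in auto)
      also have "\<dots> = 2 * B * C ^ 3 * (real k * M n) * M n"
        using elim(3) by (simp add: power2_eq_square power3_eq_cube)
      also have "\<dots> \<le> 2 * B * C ^ 3 * (real k * M n) * (C * P)"
        using P B C_ge_1 M_pos[of n] by (intro mult_left_mono) auto
      also have "\<dots> = D * (real k * M n) * P" by (simp add: D_def power4_eq_xxxx power3_eq_cube)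
      finally have 2: "S2 \<le> D * (real k * M n) * P" .
      have "\<bar>(S1 + S2) - P * conv_cdf (k - 1) (n div 2)\<bar> \<le> (\<epsilon> + D * (real k * M n)) * P"
        using 1 2 S2_nn by (simp add: algebra_simps)
      then have "\<bar>(S1 + S2) / P - conv_cdf (k - 1) (n div 2)\<bar> \<le> \<epsilon> + D * (real k * M n)"
      proof -
        have "(S1 + S2) / P - conv_cdf (k - 1) (n div 2) = ((S1 + S2) - P * conv_cdf (k - 1) (n div 2)) / P"
          using P by (simp add: diff_divide_distrib)
        then show ?thesis
          using P \<open>\<bar>(S1 + S2) - P * conv_cdf (k - 1) (n div 2)\<bar> \<le> (\<epsilon> + D * (real k * M n)) * P\<close>
          by (simp add: pos_divide_le_eq)
      qed
      then show "\<bar>conv k n / (real k * p n) - conv_cdf (k - 1) (n div 2)\<bar> \<le> \<epsilon> + D * (real k * M n)"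
        by (simp only: eq)
    qed
  qed
  then show thesis using that D by blast
qed

text \<open>On the window \<open>exp (k * tail n)\<close> is at most \<open>exp b\<close>, so
  additive errors in the chain from the ratio through \<open>conv_cdf (k - 1) (n div 2)\<close> to
  the power of \<open>cdf (n div 2)\<close> are enough.\<close>

theorem conv_window:
  assumes a: "a > 0"
  shows "((\<lambda>(n, k). conv k n / (real k * p n) * exp (real k * tail n)) \<longlongrightarrow> 1) (window a b)"
proof -
  define E where "E = (\<lambda>(n, k). exp (real k * tail n))"
  define R where "R = (\<lambda>(n, k). conv k n / (real k * p n))"
  define G where "G = (\<lambda>(n, k). conv_cdf (k - 1) (n div 2))"
  define Y where "Y = (\<lambda>(n, k). cdf (n div 2) ^ (k - 1))"
  have k1: "\<forall>\<^sub>F x in window a b. snd x \<ge> 1"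
    using window_snd[OF a] unfolding filterlim_at_top by blast
  have E_bound: "\<forall>\<^sub>F x in window a b. 0 \<le> E x \<and> E x \<le> exp b"
    using window_mem by eventually_elim (auto simp: E_def)
  have kM: "((\<lambda>(n, k). real k * M n) \<longlongrightarrow> 0) (window a b)"
    by (rule window_null[OF M_tail])
  have E_null: "((\<lambda>x. E x * f x) \<longlongrightarrow> 0) (window a b)" if "(f \<longlongrightarrow> 0) (window a b)" for f
  proof (rule Lim_null_comparison)
    show "((\<lambda>x. exp b * \<bar>f x\<bar>) \<longlongrightarrow> 0) (window a b)"
      using tendsto_mult[OF tendsto_const tendsto_rabs[OF that], of "exp b"] by simp
    show "\<forall>\<^sub>F x in window a b. norm (E x * f x) \<le> exp b * \<bar>f x\<bar>"
      using E_bound by eventually_elim (simp add: abs_mult mult_right_mono)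
  qed
  have RG: "((\<lambda>x. R x - G x) \<longlongrightarrow> 0) (window a b)"
  proof (rule tendstoI)
    fix \<epsilon> :: real assume \<epsilon>: "\<epsilon> > 0"
    obtain D where D: "D \<ge> 0"
        "\<And>\<epsilon>. \<epsilon> > 0 \<Longrightarrow> \<forall>\<^sub>F n in sequentially. \<forall>k\<ge>1.
           \<bar>conv k n / (real k * p n) - conv_cdf (k - 1) (n div 2)\<bar> \<le> \<epsilon> + D * (real k * M n)"
      using conv_ratio_approx by blast
    have "\<forall>\<^sub>F x in window a b. (case x of (n, k) \<Rightarrow> \<forall>k\<ge>1.
           \<bar>conv k n / (real k * p n) - conv_cdf (k - 1) (n div 2)\<bar> \<le> \<epsilon> / 2 + D * (real k * M n))"
      using eventually_compose_filterlim[OF D(2)[of "\<epsilon> / 2"] window_fst] \<epsilon> by (simp add: case_prod_unfold)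
    moreover have "\<forall>\<^sub>F x in window a b. D * (case x of (n, k) \<Rightarrow> real k * M n) < \<epsilon> / 2"
      using tendsto_mult[OF tendsto_const kM, of D] \<epsilon> by (intro order_tendstoD(2)) auto
    ultimately show "\<forall>\<^sub>F x in window a b. dist (R x - G x) 0 < \<epsilon>"
      using k1 by eventually_elim (fastforce simp: R_def G_def)
  qed
  have GY: "((\<lambda>x. G x - Y x) \<longlongrightarrow> 0) (window a b)"
  proof (rule Lim_null_comparison)
    show "((\<lambda>x. 2 * C ^ 4 * (case x of (n, k) \<Rightarrow> real k * M n)) \<longlongrightarrow> 0) (window a b)"
      using tendsto_mult[OF tendsto_const kM, of "2 * C ^ 4"] by simp
    have "\<forall>\<^sub>F x in window a b. fst x \<ge> 2"
      using window_fst unfolding filterlim_at_top by blast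
    then show "\<forall>\<^sub>F x in window a b. norm (G x - Y x) \<le> 2 * C ^ 4 * (case x of (n, k) \<Rightarrow> real k * M n)"
    proof eventually_elim
      case (elim x)
      obtain n k where x: "x = (n, k)" by force
      define h where "h = n div 2"
      have h: "h \<ge> 1" using elim by (auto simp: x h_def)
      \<comment> \<open>With \<open>s = n = h\<close> the offset in the truncated Markov inequality
        vanishes, and its error \<open>k * E / h\<close> is of order \<open>k * M h\<close>, hence
        of order \<open>k * M n\<close>.\<close>
      have "conv_cdf (k - 1) h \<ge> cdf h ^ (k - 1) - (real (k - 1) * (\<Sum>m\<le>h. real m * p m)) / real h"
        using conv_cdf_ge[of h h "k - 1"] h by simp
      moreover have "(real (k - 1) * (\<Sum>m\<le>h. real m * p m)) / real h \<le> (real k * (C\<^sup>2 * real h * M h)) / real h"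
        using size_bias_sum_le[OF h] h
        by (intro divide_right_mono mult_mono sum_nonneg mult_nonneg_nonneg p_nonneg) auto
      moreover have "(real k * (C\<^sup>2 * real h * M h)) / real h = C\<^sup>2 * real k * M h"
        using h by simp
      moreover have "C\<^sup>2 * real k * M h \<le> C\<^sup>2 * real k * (C\<^sup>2 * M n)"
        using M_half_le[of n] elim by (intro mult_left_mono) (auto simp: x h_def)
      moreover have "C\<^sup>2 * real k * (C\<^sup>2 * M n) = C ^ 4 * (real k * M n)"
        by (simp add: power4_eq_xxxx power2_eq_square)
      moreover have "C ^ 4 * (real k * M n) \<ge> 0" using M_pos[of n] C_ge_1 by simp
      moreover have "conv_cdf (k - 1) h \<le> cdf h ^ (k - 1)" by (rule conv_cdf_le_power)
      ultimately show ?case by (simp add: x G_def Y_def h_def)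
    qed
  qed
  have "((\<lambda>x. E x * (R x - G x) + E x * (G x - Y x) + (case x of (n, k) \<Rightarrow>
      exp (real k * tail n) * cdf (n div 2) ^ (k - 1))) \<longlongrightarrow> 0 + 0 + 1) (window a b)"
    by (intro tendsto_add E_null RG GY window_power_cdf a)
  then show ?thesis
    by (simp add: E_def R_def G_def Y_def case_prod_unfold algebra_simps)
qed

end

subsection \<open>Riemann sums and dominated convergence\<close>

lemma has_bochner_integral_Gamma:
  assumes "a > (0 :: real)"
  shows "has_bochner_integral lborel (\<lambda>x. indicator {0<..} x * (x powr (a - 1) * exp (- x))) (Gamma a)"
proof (rule has_bochner_integral_nn_integral)
  have "(\<integral>\<^sup>+x. ennreal (indicator {0<..} x * (x powr (a - 1) * exp (- x))) \<partial>lborel) =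
        (\<integral>\<^sup>+x. ennreal (indicator {0..} x * x powr (a - 1) / exp x) \<partial>lborel)"
    by (intro nn_integral_cong) (auto simp: indicator_def exp_minus field_simps)
  then show "(\<integral>\<^sup>+x. ennreal (indicator {0<..} x * (x powr (a - 1) * exp (- x))) \<partial>lborel) = ennreal (Gamma a)"
    using Gamma_conv_nn_integral_real[OF assms] by simp
qed (use assms in auto)

lemma integrable_powr_exp:
  assumes "\<beta> < (1 :: real)" "c > 0"
  shows "integrable lborel (\<lambda>x. indicator {0<..} x * (x powr (- \<beta>) * exp (- (c * x))))"
proof -
  have "integrable lborel (\<lambda>x. indicator {0<..} x * (x powr (1 - \<beta> - 1) * exp (- x)))"
    using has_bochner_integral_Gamma[of "1 - \<beta>"] assms by (simp add: has_bochner_integral_iff)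
  from lborel_integrable_real_affine[OF this, of c 0] assms
  have "integrable lborel (\<lambda>x. indicator {0<..} (c * x) * ((c * x) powr (- \<beta>) * exp (- (c * x))))"
    by simp
  from integrable_mult_right[OF this, of "c powr \<beta>"]
  show ?thesis
  proof (rule Bochner_Integration.integrable_cong[THEN iffD1, rotated 2])
    fix x show "c powr \<beta> * (indicator {0<..} (c * x) * ((c * x) powr (- \<beta>) * exp (- (c * x)))) =
      indicator {0<..} x * (x powr (- \<beta>) * exp (- (c * x)))"
      using assms by (auto simp: indicator_def powr_mult powr_minus zero_less_mult_iff)
  qed simp
qed

text \<open>Writes a series as the integral of a step function of mesh \<open>\<tau>\<close>, so
  that dominated convergence for integrals applies while mesh and terms both vary. The ceiling
  evaluates at the right endpoint of each cell, hence the indices start at 1.\<close>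

lemma step_function_integral:
  fixes s :: "nat \<Rightarrow> real"
  assumes \<tau>: "\<tau> > 0" and s: "summable (\<lambda>k. \<bar>s (Suc k)\<bar>)"
  shows "integrable lborel (\<lambda>x. indicator {0<..} x * s (nat \<lceil>x / \<tau>\<rceil>))"
    and "(\<integral>x. indicator {0<..} x * s (nat \<lceil>x / \<tau>\<rceil>) \<partial>lborel) = \<tau> * (\<Sum>k. s (Suc k))"
proof -
  define f where "f = (\<lambda>k x. s (Suc k) * indicator {real k * \<tau><..real (Suc k) * \<tau>} x)"
  have ind: "x \<in> {real k * \<tau><..real (Suc k) * \<tau>} \<longleftrightarrow> x > 0 \<and> nat \<lceil>x / \<tau>\<rceil> = Suc k" for x k
  proof -
    have "x \<in> {real k * \<tau><..real (Suc k) * \<tau>} \<longleftrightarrow> real k < x / \<tau> \<and> x / \<tau> \<le> real k + 1"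
      using \<tau> by (simp add: field_simps)
    also have "\<dots> \<longleftrightarrow> \<lceil>x / \<tau>\<rceil> = int (Suc k)"
      by (simp add: ceiling_eq_iff add.commute)
    also have "\<dots> \<longleftrightarrow> nat \<lceil>x / \<tau>\<rceil> = Suc k" by linarith
    also have "\<dots> \<longleftrightarrow> x > 0 \<and> nat \<lceil>x / \<tau>\<rceil> = Suc k"
    proof -
      have "x > 0" if "nat \<lceil>x / \<tau>\<rceil> = Suc k"
      proof -
        have "\<lceil>x / \<tau>\<rceil> > 0" using that by linarith
        then show ?thesis using \<tau> by (simp add: zero_less_divide_iff)
      qed
      then show ?thesis by auto
    qed
    finally show ?thesis .
  qed
  have len: "(\<integral>x. indicator {real k * \<tau><..real (Suc k) * \<tau>} x \<partial>lborel) = \<tau>" for k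
    using \<tau> by (simp add: algebra_simps)
  have f_int: "integrable lborel (f k)" for k
    unfolding f_def using \<tau> by (intro integrable_mult_right integrable_real_indicator) auto
  \<comment> \<open>The supports are disjoint, so one index at most contributes. For
    \<open>x \<le> 0\<close> truncated subtraction points to index 0, whose term vanishes by
    \<open>f_neg\<close>.\<close>
  have f_zero: "f k x = 0" if "k \<noteq> nat \<lceil>x / \<tau>\<rceil> - 1" for k x
    using that ind[of x k] by (auto simp: f_def indicator_def)
  have f_neg: "f k x = 0" if "\<not> x > 0" for k x
  proof -
    have "x \<notin> {real k * \<tau><..real (Suc k) * \<tau>}" using ind that by blast
    then have "indicator {real k * \<tau><..real (Suc k) * \<tau>} x = (0::real)" by (rule indicator_simps(2))
    then show ?thesis unfolding f_def by (rule mult_eq_0_iff[THEN iffD2, OF disjI2])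
  qed
  have f_sum: "(\<Sum>k. f k x) = indicator {0<..} x * s (nat \<lceil>x / \<tau>\<rceil>)" for x
  proof -
    let ?k = "nat \<lceil>x / \<tau>\<rceil> - 1"
    have "(\<Sum>k. f k x) = f ?k x"
      using suminf_finite[OF finite.insertI[OF finite.emptyI], of ?k "\<lambda>k. f k x", OF f_zero]
      by (simp only: sum.insert finite.emptyI empty_iff simp_thms sum.empty add_0_right singleton_iff)
    also have "\<dots> = indicator {0<..} x * s (nat \<lceil>x / \<tau>\<rceil>)"
    proof (cases "x > 0")
      case True
      then have "\<lceil>x / \<tau>\<rceil> > 0" using \<tau> by simp
      then have "nat \<lceil>x / \<tau>\<rceil> = Suc ?k" by linarith
      then have "x \<in> {real ?k * \<tau><..real (Suc ?k) * \<tau>}" using ind[of x ?k] True by blast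
      then have "indicator {real ?k * \<tau><..real (Suc ?k) * \<tau>} x = (1::real)" by (rule indicator_simps(1))
      then have "f ?k x = s (Suc ?k)" unfolding f_def by (simp only: mult_1_right)
      also have "Suc ?k = nat \<lceil>x / \<tau>\<rceil>" using \<open>nat \<lceil>x / \<tau>\<rceil> = Suc ?k\<close> by (rule sym)
      finally show ?thesis using True by (simp add: indicator_def)
    next
      case False
      then show ?thesis unfolding f_neg[OF False] by (simp add: indicator_def)
    qed
    finally show ?thesis .
  qed
  have sm: "AE x in lborel. summable (\<lambda>k. norm (f k x))"
  proof (rule AE_I2)
    fix x show "summable (\<lambda>k. norm (f k x))"
      by (rule summable_finite[of "{nat \<lceil>x / \<tau>\<rceil> - 1}"]) (auto simp: f_zero)
  qed
  have "norm (f k x) = \<bar>s (Suc k)\<bar> * indicator {real k * \<tau><..real (Suc k) * \<tau>} x" for k x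
    unfolding f_def norm_mult by (simp add: indicator_def)
  then have "(\<integral>x. norm (f k x) \<partial>lborel) = \<bar>s (Suc k)\<bar> * \<tau>" for k
    by (simp only: integral_mult_right_zero len)
  then have sn: "summable (\<lambda>k. \<integral>x. norm (f k x) \<partial>lborel)"
    using summable_mult2[OF s, of \<tau>] by simp
  show "integrable lborel (\<lambda>x. indicator {0<..} x * s (nat \<lceil>x / \<tau>\<rceil>))"
    using integrable_suminf[OF f_int sm sn] by (simp add: f_sum)
  have "(\<integral>x. indicator {0<..} x * s (nat \<lceil>x / \<tau>\<rceil>) \<partial>lborel) = (\<Sum>k. \<integral>x. f k x \<partial>lborel)"
    using integral_suminf[OF f_int sm sn] by (simp add: f_sum)
  also have "\<dots> = (\<Sum>k. \<tau> * s (Suc k))"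
    unfolding f_def integral_mult_right_zero len by (simp add: mult.commute)
  also have "\<dots> = \<tau> * (\<Sum>k. s (Suc k))"
    by (rule suminf_mult[OF summable_rabs_cancel[OF s]])
  finally show "(\<integral>x. indicator {0<..} x * s (nat \<lceil>x / \<tau>\<rceil>) \<partial>lborel) = \<tau> * (\<Sum>k. s (Suc k))" .
qed

text \<open>The majorant is decreasing because \<open>\<beta> \<ge> 0\<close>, so its value at the
  right endpoint \<open>k * \<tau> n \<ge> x\<close> is at most its value at \<open>x\<close>;
  \<open>\<beta> < 1\<close> makes it integrable at 0. Convergence almost everywhere leaves room for
  test functions with jumps.\<close>

lemma riemann_sum_dominated:
  fixes c :: "nat \<Rightarrow> nat \<Rightarrow> real" and \<tau> :: "nat \<Rightarrow> real"
  assumes \<tau>: "\<And>n. \<tau> n > 0" and \<beta>: "0 \<le> \<beta>" "\<beta> < 1" and r: "r > 0"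
    and bound: "\<forall>\<^sub>F n in sequentially. \<forall>k\<ge>1.
          \<bar>c n k\<bar> \<le> H * ((real k * \<tau> n) powr (- \<beta>) * exp (- (r * (real k * \<tau> n))))"
    and \<phi>: "\<phi> \<in> borel_measurable borel"
    and lim: "AE x in lborel. x > 0 \<longrightarrow> (\<lambda>n. c n (nat \<lceil>x / \<tau> n\<rceil>)) \<longlonglongrightarrow> \<phi> x"
  shows "\<forall>\<^sub>F n in sequentially. summable (\<lambda>k. c n (Suc k))"
    and "(\<lambda>n. \<tau> n * (\<Sum>k. c n (Suc k))) \<longlonglongrightarrow> (\<integral>x. indicator {0<..} x * \<phi> x \<partial>lborel)"
proof -
  obtain N where N: "\<And>n k. n \<ge> N \<Longrightarrow> k \<ge> 1 \<Longrightarrow>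
      \<bar>c n k\<bar> \<le> H * ((real k * \<tau> n) powr (- \<beta>) * exp (- (r * (real k * \<tau> n))))"
    using bound unfolding eventually_sequentially by blast
  have H: "H \<ge> 0"
  proof -
    define e where "e = (real 1 * \<tau> N) powr (- \<beta>) * exp (- (r * (real 1 * \<tau> N)))"
    have "e > 0" using \<tau>[of N] by (simp add: e_def)
    moreover have "0 \<le> H * e" using N[of N 1] unfolding e_def by (meson abs_ge_zero order.refl order.trans)
    ultimately show ?thesis by (simp add: zero_le_mult_iff)
  qed
  have smb: "summable (\<lambda>k. \<bar>c n (Suc k)\<bar>)" if "n \<ge> N" for n
  proof (rule summable_comparison_test')
    let ?q = "exp (- (r * \<tau> n))"
    have "?q < 1" using \<tau>[of n] r by simp
    then show "summable (\<lambda>k. (H * \<tau> n powr (- \<beta>) * ?q) * ?q ^ k)"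
      by (intro summable_mult summable_geometric) simp
    fix k :: nat assume "k \<ge> 0"
    have "(real (Suc k) * \<tau> n) powr (- \<beta>) \<le> \<tau> n powr (- \<beta>)"
      using \<beta> \<tau>[of n] by (intro powr_mono2') (auto simp: algebra_simps)
    note powr_le = this
    have "\<bar>c n (Suc k)\<bar> \<le> H * ((real (Suc k) * \<tau> n) powr (- \<beta>) * exp (- (r * (real (Suc k) * \<tau> n))))"
      by (rule N[OF that]) simp
    also have "\<dots> \<le> H * (\<tau> n powr (- \<beta>) * exp (- (r * (real (Suc k) * \<tau> n))))"
      by (intro mult_left_mono mult_right_mono powr_le H exp_ge_zero)
    also have "exp (- (r * (real (Suc k) * \<tau> n))) = ?q ^ Suc k"
      by (simp only: exp_of_nat_mult[symmetric]) (simp add: algebra_simps)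
    finally show "norm \<bar>c n (Suc k)\<bar> \<le> (H * \<tau> n powr (- \<beta>) * ?q) * ?q ^ k"
      by (simp only: real_norm_def abs_abs power_Suc mult.assoc)
  qed
  show "\<forall>\<^sub>F n in sequentially. summable (\<lambda>k. c n (Suc k))"
    using eventually_ge_at_top[of N] by eventually_elim (rule summable_rabs_cancel[OF smb])
  \<comment> \<open>Shifted by \<open>N\<close>, so that the domination holds for every member of
    the sequence.\<close>
  define g where "g = (\<lambda>n x. indicator {0<..} x * c (n + N) (nat \<lceil>x / \<tau> (n + N)\<rceil>))"
  define w where "w = (\<lambda>x. H * (indicator {0<..} x * (x powr (- \<beta>) * exp (- (r * x)))))"
  have "(\<lambda>n. \<integral>x. g n x \<partial>lborel) \<longlonglongrightarrow> (\<integral>x. indicator {0<..} x * \<phi> x \<partial>lborel)"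
  proof (rule integral_dominated_convergence[where w = w])
    show "integrable lborel w"
      unfolding w_def using \<beta> r by (intro integrable_mult_right integrable_powr_exp)
    show "(\<lambda>x. indicator {0<..} x * \<phi> x) \<in> borel_measurable lborel" using \<phi> by simp
    show "g n \<in> borel_measurable lborel" for n
      unfolding g_def using step_function_integral(1)[OF \<tau>[of "n + N"] smb[of "n + N"]]
      by (intro borel_measurable_integrable) simp
    show "AE x in lborel. (\<lambda>n. g n x) \<longlonglongrightarrow> indicator {0<..} x * \<phi> x"
      using lim
    proof eventually_elim
      case (elim x)
      then show ?case
        unfolding g_def using LIMSEQ_ignore_initial_segment[of _ "\<phi> x" N]
        by (cases "x > 0") auto
    qed
    show "AE x in lborel. norm (g n x) \<le> w x" for n
    proof (rule AE_I2)
      fix x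
      show "norm (g n x) \<le> w x"
      proof (cases "x > 0")
        case True
        define t where "t = \<tau> (n + N)"
        define k where "k = nat \<lceil>x / t\<rceil>"
        have t: "t > 0" using \<tau> by (simp add: t_def)
        then have "x / t > 0" using True by simp
        then have "k \<ge> 1" "real k \<ge> x / t" unfolding k_def by linarith+
        then have kt: "x \<le> real k * t" using t by (simp add: field_simps)
        have "\<bar>c (n + N) k\<bar> \<le> H * ((real k * t) powr (- \<beta>) * exp (- (r * (real k * t))))"
          using N[of "n + N" k] \<open>k \<ge> 1\<close> by (simp add: t_def)
        also have "\<dots> \<le> H * (x powr (- \<beta>) * exp (- (r * x)))"
          using H kt True \<beta> r by (intro mult_left_mono mult_mono powr_mono2') auto
        finally show ?thesis using True by (simp add: g_def w_def k_def t_def)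
      qed (simp add: g_def w_def)
    qed
  qed
  moreover have "(\<integral>x. g n x \<partial>lborel) = \<tau> (n + N) * (\<Sum>k. c (n + N) (Suc k))" for n
    unfolding g_def using step_function_integral(2)[OF \<tau>[of "n + N"] smb[of "n + N"]] by simp
  ultimately have "(\<lambda>n. \<tau> (n + N) * (\<Sum>k. c (n + N) (Suc k))) \<longlonglongrightarrow> (\<integral>x. indicator {0<..} x * \<phi> x \<partial>lborel)"
    by simp
  then show "(\<lambda>n. \<tau> n * (\<Sum>k. c n (Suc k))) \<longlonglongrightarrow> (\<integral>x. indicator {0<..} x * \<phi> x \<partial>lborel)"
    by (rule LIMSEQ_offset)
qed

lemma powr_exp_bound:
  fixes s :: real
  assumes c: "c > 0"
  obtains H where "H \<ge> 0" "\<And>z. z \<ge> 1 \<Longrightarrow> z powr s \<le> H * exp (c * z)"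
proof -
  define N where "N = nat \<lceil>s\<rceil>"
  \<comment> \<open>Undoes the coefficient of the single term of index \<open>N\<close> in the
    exponential series of \<open>c * z\<close>, which alone dominates
    \<open>z powr s\<close>.\<close>
  define H where "H = fact N / c ^ N"
  have "z powr s \<le> H * exp (c * z)" if "z \<ge> 1" for z
  proof -
    have "z powr s \<le> z powr real N" using that by (intro powr_mono) (auto simp: N_def, linarith)
    also have "\<dots> = z ^ N" using that by (simp add: powr_realpow)
    also have "\<dots> = H * ((c * z) ^ N / fact N)" using c by (simp add: H_def power_mult_distrib)
    also have "\<dots> \<le> H * exp (c * z)"
    proof (intro mult_left_mono)
      have "(\<Sum>k\<in>{N}. (c * z) ^ k /\<^sub>R fact k) \<le> (\<Sum>k. (c * z) ^ k /\<^sub>R fact k)"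
        using c that by (intro sum_le_suminf summable_exp_generic) auto
      then show "(c * z) ^ N / fact N \<le> exp (c * z)" by (simp add: exp_def field_simps)
    qed (use c in \<open>simp add: H_def\<close>)
    finally show ?thesis .
  qed
  then show thesis using that[of H] c by (simp add: H_def)
qed

text \<open>For \<open>z \<ge> 1\<close> weakening \<open>exp (- (z / 2))\<close> to
  \<open>exp (- (z / 4))\<close> absorbs all powers. For \<open>z < 1\<close> the exponent
  \<open>q + a - \<delta>\<close> is at least \<open>- max 0 (\<delta> - a)\<close>; the maximum
  with 0 keeps the majorant decreasing.\<close>

lemma powr_max_exp_bound:
  fixes a q \<delta> :: real
  assumes q: "q \<ge> 0" and \<delta>: "\<delta> \<ge> 0"
  obtains H where "H \<ge> 0" "\<And>z. z > 0 \<Longrightarrow>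
    z powr q * (z powr a * max z (1 / z) powr \<delta> * exp (- (z / 2)))
      \<le> H * (z powr (- max 0 (\<delta> - a)) * exp (- (1 / 4 * z)))"
proof -
  define b where "b = max 0 (\<delta> - a)"
  obtain H where H: "H \<ge> 0" "\<And>z. z \<ge> 1 \<Longrightarrow> z powr (q + a + \<delta> + b) \<le> H * exp (1 / 4 * z)"
    using powr_exp_bound[of "1 / 4" "q + a + \<delta> + b"] by auto
  have "z powr q * (z powr a * max z (1 / z) powr \<delta> * exp (- (z / 2)))
      \<le> max 1 H * (z powr (- b) * exp (- (1 / 4 * z)))" if z: "z > 0" for z
  proof (cases "z \<ge> 1")
    case True
    then have "max z (1 / z) = z" by (simp add: max_def field_simps) (smt (verit) mult_le_cancel_left1)
    then have "z powr q * (z powr a * max z (1 / z) powr \<delta> * exp (- (z / 2))) =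
        z powr (q + a + \<delta> + b) * (z powr (- b) * exp (- (z / 2)))"
      using z by (simp flip: powr_add mult.assoc add: add_ac)
    also have "\<dots> \<le> (H * exp (1 / 4 * z)) * (z powr (- b) * exp (- (z / 2)))"
      using H(2)[OF True] by (intro mult_right_mono) auto
    also have "\<dots> = H * (z powr (- b) * exp (- (1 / 4 * z)))"
      by (simp flip: exp_add add: mult_ac)
    also have "\<dots> \<le> max 1 H * (z powr (- b) * exp (- (1 / 4 * z)))"
      by (intro mult_right_mono) auto
    finally show ?thesis .
  next
    case False
    then have "max z (1 / z) = 1 / z" using z by (simp add: max_def field_simps) (smt (verit) mult_le_cancel_left1)
    then have "z powr q * (z powr a * max z (1 / z) powr \<delta> * exp (- (z / 2))) =
        z powr (q + a - \<delta>) * exp (- (z / 2))"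
      using z by (simp add: powr_add powr_diff powr_divide)
    also have "\<dots> \<le> z powr (- b) * exp (- (1 / 4 * z))"
      using z False q by (intro mult_mono powr_mono') (auto simp: b_def)
    also have "\<dots> \<le> max 1 H * (z powr (- b) * exp (- (1 / 4 * z)))"
      using mult_right_mono[of 1 "max 1 H" "z powr (- b) * exp (- (1 / 4 * z))"]
      by (simp only: mult_1 max.cobounded1 mult_nonneg_nonneg powr_ge_zero exp_ge_zero simp_thms)
    finally show ?thesis .
  qed
  then show thesis using that[of "max 1 H"] by (simp add: b_def)
qed

subsection \<open>Weighted sums over the number of summands\<close>

text \<open>\<open>a k\<close> is the tilted weight of having \<open>k\<close> summands, and
  \<open>V\<close> is the globally positive version of \<open>L\<close>. The Potter exponent
  (\<alpha> + 1) / 2 worsens the power \<alpha> at 0 to (\<alpha> - 1) / 2, still above -1.\<close>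

locale weighted_slow_density = slow_density +
  fixes a :: "nat \<Rightarrow> real" and \<alpha> :: real and L V :: "real \<Rightarrow> real"
  assumes \<alpha>: "\<alpha> > -1"
    and a_nonneg: "k \<ge> 1 \<Longrightarrow> a k \<ge> 0"
    and L: "slowly_varying L"
    and a_asymp: "a \<sim>[sequentially] (\<lambda>k. L (real k) * real k powr (\<alpha> - 1))"
    and V_pos: "V x > 0" and V_eq: "\<forall>\<^sub>F x in at_top. V x = L x"
    and V_potter: "x > 0 \<Longrightarrow> y > 0 \<Longrightarrow>
      V y \<le> exp ((\<alpha> + 1) / 2) * max (y / x) (x / y) powr ((\<alpha> + 1) / 2) * V x"
begin

text \<open>The size of \<open>a k * conv k n\<close> on a window:
  \<open>V * k powr (\<alpha> - 1)\<close> times \<open>k * p n * exp (- x)\<close>, with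
  \<open>x = k * tail n\<close> and \<open>k powr \<alpha>\<close> written as
  \<open>x powr \<alpha>\<close> times \<open>(1 / tail n) powr \<alpha>\<close>.\<close>

definition scale :: "nat \<Rightarrow> real" where
  "scale n = p n * (1 / tail n) powr \<alpha> * V (1 / tail n)"

lemma inverse_tail_at_top: "filterlim (\<lambda>n. 1 / tail n) at_top sequentially"
  using filterlim_inverse_at_top[OF tail_tendsto_0] tail_pos by (simp add: inverse_eq_divide)

lemma eventually_p_pos: "\<forall>\<^sub>F n in sequentially. p n > 0"
  using p_ge
proof eventually_elim
  case (elim n)
  then show ?case using M_pos[of n] p_nonneg[of n] by (cases "p n = 0") auto
qed

lemma eventually_scale_pos: "\<forall>\<^sub>F n in sequentially. scale n > 0"
  using eventually_p_pos
  by eventually_elim (use tail_pos V_pos in \<open>simp add: scale_def less_imp_neq[THEN not_sym]\<close>)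

lemma L_eventually_pos: "\<forall>\<^sub>F x in at_top. L x > 0"
  using L by (simp add: slowly_varying_def)

lemma L_nat_eventually_pos: "\<forall>\<^sub>F k in sequentially. L (real k) > 0"
  using eventually_compose_filterlim[OF L_eventually_pos filterlim_real_sequentially] .

lemma a_ratio: "(\<lambda>k. a k / (L (real k) * real k powr (\<alpha> - 1))) \<longlonglongrightarrow> 1"
proof (rule asymp_equivD_strong[OF a_asymp])
  show "\<forall>\<^sub>F k in sequentially. a k \<noteq> 0 \<or> L (real k) * real k powr (\<alpha> - 1) \<noteq> 0"
    using L_nat_eventually_pos eventually_gt_at_top[of 0] by eventually_elim auto
qed

lemma a_le:
  obtains A where "A \<ge> 0" "\<And>k. k \<ge> 1 \<Longrightarrow> a k \<le> A * (real k powr (\<alpha> - 1) * V (real k))"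
proof -
  have "(\<lambda>k. a k / (real k powr (\<alpha> - 1) * V (real k))) \<longlonglongrightarrow> 1"
  proof (rule Lim_transform_eventually[OF a_ratio])
    show "\<forall>\<^sub>F k in sequentially. a k / (L (real k) * real k powr (\<alpha> - 1)) = a k / (real k powr (\<alpha> - 1) * V (real k))"
      using eventually_compose_filterlim[OF V_eq filterlim_real_sequentially]
      by eventually_elim (simp add: mult.commute)
  qed
  then have "Bseq (\<lambda>k. a k / (real k powr (\<alpha> - 1) * V (real k)))"
    by (intro convergent_imp_Bseq) (auto simp: convergent_def)
  then obtain A where A: "A > 0" "\<And>k. norm (a k / (real k powr (\<alpha> - 1) * V (real k))) \<le> A"
    unfolding Bseq_def by blast
  have "a k \<le> A * (real k powr (\<alpha> - 1) * V (real k))" if "k \<ge> 1" for k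
  proof -
    have "real k powr (\<alpha> - 1) * V (real k) > 0" using that V_pos by simp
    moreover have "a k / (real k powr (\<alpha> - 1) * V (real k)) \<le> A"
      using A(2)[of k] unfolding real_norm_def by (rule abs_le_D1)
    ultimately show ?thesis by (simp add: pos_divide_le_eq)
  qed
  then show thesis using that[of A] A by auto
qed

text \<open>The quotient is a product of three factors tending to 1: the asymptotics of
  \<open>a\<close>, the ratio of \<open>L\<close> at \<open>k\<close> and at
  \<open>1 / tail n\<close>, whose quotient \<open>k * tail n\<close> ranges over a compact
  interval, and the local limit of \<open>conv\<close>.\<close>

lemma weighted_window:
  assumes c: "c > 0"
  shows "((\<lambda>(n, k). a k * conv k n / (scale n *
      ((real k * tail n) powr \<alpha> * exp (- (real k * tail n))))) \<longlongrightarrow> 1) (window c d)"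
proof -
  have at: "filterlim (\<lambda>x. 1 / tail (fst x)) at_top (window c d)"
    by (rule filterlim_compose[OF inverse_tail_at_top window_fst])
  have snd_real: "filterlim (\<lambda>x. real (snd x)) at_top (window c d)"
    by (rule filterlim_compose[OF filterlim_real_sequentially window_snd[OF c]])
  have 1: "((\<lambda>x. a (snd x) / (L (real (snd x)) * real (snd x) powr (\<alpha> - 1))) \<longlongrightarrow> 1) (window c d)"
    by (rule filterlim_compose[OF a_ratio window_snd[OF c]])
  have 2: "((\<lambda>x. L (real (snd x)) / L (1 / tail (fst x))) \<longlongrightarrow> 1) (window c d)"
  proof (rule tendstoI)
    fix \<epsilon> :: real assume "\<epsilon> > 0"
    from eventually_compose_filterlim[OF slowly_varying_ratio_uniform[OF L c this, of d] at] window_mem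
    show "\<forall>\<^sub>F x in window c d. dist (L (real (snd x)) / L (1 / tail (fst x))) 1 < \<epsilon>"
    proof eventually_elim
      case (elim x)
      have "real (snd x) * tail (fst x) * (1 / tail (fst x)) = real (snd x)"
        using tail_pos[of "fst x"] by simp
      moreover have "real (snd x) * tail (fst x) \<in> {c..d}" using elim(2) by (simp add: case_prod_unfold)
      ultimately show ?case using bspec[OF elim(1)] by (metis dist_real_def)
    qed
  qed
  have 3: "((\<lambda>x. conv (snd x) (fst x) / (real (snd x) * p (fst x)) * exp (real (snd x) * tail (fst x))) \<longlongrightarrow> 1) (window c d)"
    using conv_window[OF c, of d] by (simp add: case_prod_unfold)
  have "\<forall>\<^sub>F x in window c d. (a (snd x) / (L (real (snd x)) * real (snd x) powr (\<alpha> - 1))) *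
      (L (real (snd x)) / L (1 / tail (fst x))) *
      (conv (snd x) (fst x) / (real (snd x) * p (fst x)) * exp (real (snd x) * tail (fst x))) =
      (case x of (n, k) \<Rightarrow> a k * conv k n / (scale n *
      ((real k * tail n) powr \<alpha> * exp (- (real k * tail n)))))"
    using eventually_compose_filterlim[OF V_eq at] eventually_compose_filterlim[OF L_eventually_pos at]
      eventually_compose_filterlim[OF L_eventually_pos snd_real]
      eventually_compose_filterlim[OF eventually_gt_at_top[of 0] snd_real]
      eventually_compose_filterlim[OF eventually_p_pos window_fst]
  proof eventually_elim
    case (elim x)
    obtain n k where x: "x = (n, k)" by force
    have k: "real k > 0" and t: "tail n > 0" and pn: "p n > 0" using elim tail_pos by (auto simp: x)
    have "(1 / tail n) powr \<alpha> * (real k * tail n) powr \<alpha> = real k powr \<alpha>"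
      using t k by (simp add: powr_mult powr_divide)
    moreover have "real k powr \<alpha> = real k powr (\<alpha> - 1) * real k"
      using k powr_add[of "real k" "\<alpha> - 1" 1] by simp
    ultimately have s: "scale n * ((real k * tail n) powr \<alpha> * exp (- (real k * tail n))) =
        real k powr (\<alpha> - 1) * real k * p n * L (1 / tail n) / exp (real k * tail n)"
      using elim by (simp add: scale_def x exp_minus divide_inverse mult_ac)
    have nz: "L (real k) \<noteq> 0" "L (1 / tail n) \<noteq> 0" "real k powr (\<alpha> - 1) \<noteq> 0" using elim k by (auto simp: x)
    show ?case unfolding x prod.case s fst_conv snd_conv using nz k pn by (simp add: field_simps)
  qed
  with tendsto_mult[OF tendsto_mult[OF 1 2] 3] show ?thesis
    using Lim_transform_eventually by fastforce
qed

lemma weighted_bound: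
  obtains H where "H \<ge> 0" "\<forall>\<^sub>F n in sequentially. \<forall>k\<ge>1.
    a k * conv k n / scale n \<le> H * ((real k * tail n) powr \<alpha> *
      max (real k * tail n) (1 / (real k * tail n)) powr ((\<alpha> + 1) / 2) * exp (- (real k * tail n / 2)))"
proof -
  obtain A where A: "A \<ge> 0" "\<And>k. k \<ge> 1 \<Longrightarrow> a k \<le> A * (real k powr (\<alpha> - 1) * V (real k))"
    using a_le by blast
  obtain B where B: "B \<ge> 0" "\<And>k n. n \<ge> 1 \<Longrightarrow> conv k n \<le> B * real k * (M n / real n)"
    using conv_linear_bound by blast
  define \<delta> where "\<delta> = (\<alpha> + 1) / 2"
  \<comment> \<open>\<open>A * exp \<delta>\<close> comes from \<open>a_le\<close> and Potter's
    bound, \<open>4 * C * B\<close> from \<open>conv_exp_le\<close>, and the last \<open>C\<close>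
    from replacing \<open>M n / n\<close> by \<open>p n\<close>.\<close>
  define H where "H = A * exp \<delta> * (4 * C * B * C)"
  have H: "H \<ge> 0" using A B C_ge_1 by (simp add: H_def)
  have "\<forall>\<^sub>F n in sequentially. \<forall>k\<ge>1.
    a k * conv k n / scale n \<le> H * ((real k * tail n) powr \<alpha> *
      max (real k * tail n) (1 / (real k * tail n)) powr \<delta> * exp (- (real k * tail n / 2)))"
    using p_ge eventually_scale_pos eventually_ge_at_top[of 1]
  proof eventually_elim
    case (elim n)
    show ?case
    proof (intro allI impI)
      fix k :: nat assume k: "k \<ge> 1"
      define z where "z = real k * tail n"
      have t: "tail n > 0" by (rule tail_pos)
      have z: "z > 0" using k t by (simp add: z_def)
      have "M n / real n \<le> C * p n" using elim by (simp add: field_simps)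
      have "conv k n \<le> 4 * C * B * real k * (M n / real n) * exp (- (real k * tail n / 2))"
        using B elim by (intro conv_exp_le) auto
      also have "\<dots> \<le> 4 * C * B * real k * (C * p n) * exp (- (z / 2))"
        using B C_ge_1 \<open>M n / real n \<le> C * p n\<close> unfolding z_def by (intro mult_right_mono mult_left_mono) auto
      finally have 1: "conv k n \<le> 4 * C * B * real k * (C * p n) * exp (- (z / 2))" .
      have "V (real k) \<le> exp \<delta> * max z (1 / z) powr \<delta> * V (1 / tail n)"
        using V_potter[of "1 / tail n" "real k"] k t by (simp add: \<delta>_def z_def mult.commute)
      then have "a k \<le> A * (real k powr (\<alpha> - 1) * (exp \<delta> * max z (1 / z) powr \<delta> * V (1 / tail n)))"
        using A by (intro order.trans[OF A(2)[OF k]] mult_left_mono) auto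
      with 1 have "a k * conv k n \<le>
          (A * (real k powr (\<alpha> - 1) * (exp \<delta> * max z (1 / z) powr \<delta> * V (1 / tail n)))) *
          (4 * C * B * real k * (C * p n) * exp (- (z / 2)))"
        using a_nonneg[OF k] conv_nonneg[of k n] by (intro mult_mono) auto
      also have "\<dots> = H * (max z (1 / z) powr \<delta> * exp (- (z / 2))) *
          (real k powr (\<alpha> - 1) * real k * p n * V (1 / tail n))"
        by (simp add: H_def mult_ac)
      also have "real k powr (\<alpha> - 1) * real k = real k powr \<alpha>"
        using k powr_add[of "real k" "\<alpha> - 1" 1] by simp
      also have "\<dots> = (1 / tail n) powr \<alpha> * z powr \<alpha>"
        using t k by (simp add: z_def powr_mult powr_divide)
      finally have "a k * conv k n \<le> (H * (z powr \<alpha> * max z (1 / z) powr \<delta> * exp (- (z / 2)))) * scale n"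
        by (simp add: scale_def mult_ac)
      then show "a k * conv k n / scale n \<le> H * ((real k * tail n) powr \<alpha> *
          max (real k * tail n) (1 / (real k * tail n)) powr \<delta> * exp (- (real k * tail n / 2)))"
        using elim(2) by (simp add: pos_divide_le_eq z_def)
    qed
  qed
  then show thesis using that H unfolding \<delta>_def by blast
qed

text \<open>Rounding up moves \<open>x\<close> by at most one mesh width \<open>tail n\<close>, so
  each fixed \<open>x > 0\<close> yields a path of pairs along which window limits can be read
  off.\<close>

lemma window_ceiling:
  assumes x: "x > 0"
  shows "filterlim (\<lambda>n. (n, nat \<lceil>x / tail n\<rceil>)) (window (x / 2) (2 * x)) sequentially"
    and "(\<lambda>n. real (nat \<lceil>x / tail n\<rceil>) * tail n) \<longlonglongrightarrow> x"
proof -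
  have b: "x \<le> real (nat \<lceil>x / tail n\<rceil>) * tail n \<and> real (nat \<lceil>x / tail n\<rceil>) * tail n \<le> x + tail n" for n
  proof -
    have t: "tail n > 0" by (rule tail_pos)
    then have "x / tail n > 0" using x by simp
    then have "x / tail n \<le> real (nat \<lceil>x / tail n\<rceil>)" "real (nat \<lceil>x / tail n\<rceil>) \<le> x / tail n + 1"
      by linarith+
    then show ?thesis using t by (simp add: field_simps)
  qed
  have lim: "(\<lambda>n. x + tail n) \<longlonglongrightarrow> x"
    using tendsto_add[OF tendsto_const tail_tendsto_0, of x] by simp
  show "(\<lambda>n. real (nat \<lceil>x / tail n\<rceil>) * tail n) \<longlonglongrightarrow> x"
    by (rule tendsto_sandwich[OF _ _ tendsto_const lim]) (use b in auto)
  have ev: "\<forall>\<^sub>F n in sequentially. x + tail n < 2 * x"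
    using order_tendstoD(2)[OF lim, of "2 * x"] x by simp
  show "filterlim (\<lambda>n. (n, nat \<lceil>x / tail n\<rceil>)) (window (x / 2) (2 * x)) sequentially"
    unfolding filterlim_iff eventually_window
  proof (intro allI impI)
    fix P assume "\<forall>\<^sub>F n in sequentially. \<forall>k. real k * tail n \<in> {x / 2..2 * x} \<longrightarrow> P (n, k)"
    with ev show "\<forall>\<^sub>F n in sequentially. P (n, nat \<lceil>x / tail n\<rceil>)"
    proof eventually_elim
      case (elim n)
      have "real (nat \<lceil>x / tail n\<rceil>) * tail n \<in> {x / 2..2 * x}"
        unfolding atLeastAtMost_iff using b[of n] elim(1) x by linarith
      then show ?case by (rule elim(2)[rule_format])
    qed
  qed
qed

text \<open>One statement for all three uses of the test function: a constant for the normalisation,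
  an indicator for the distribution function, a power for the moments.\<close>

theorem weighted_sum_tendsto:
  assumes q: "q \<ge> 0" and \<psi>_meas: "\<psi> \<in> borel_measurable borel"
    and \<psi>_le: "\<forall>z>0. \<bar>\<psi> z\<bar> \<le> z powr q"
    and \<psi>_cont: "AE x in lborel. isCont \<psi> x"
  shows "\<forall>\<^sub>F n in sequentially. summable (\<lambda>k. \<psi> (real (Suc k) * tail n) * (a (Suc k) * conv (Suc k) n))"
    and "(\<lambda>n. tail n * (\<Sum>k. \<psi> (real (Suc k) * tail n) * (a (Suc k) * conv (Suc k) n)) / scale n)
           \<longlonglongrightarrow> (\<integral>x. indicator {0<..} x * (\<psi> x * (x powr \<alpha> * exp (- x))) \<partial>lborel)"
proof -
  define \<delta> where "\<delta> = (\<alpha> + 1) / 2"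
  \<comment> \<open>\<open>\<delta> - \<alpha> = (1 - \<alpha>) / 2\<close>, which is below 1
    exactly when \<alpha> > -1.\<close>
  define \<beta> where "\<beta> = max 0 (\<delta> - \<alpha>)"
  have \<beta>: "0 \<le> \<beta>" "\<beta> < 1" using \<alpha> by (auto simp: \<beta>_def \<delta>_def field_simps)
  define c where "c = (\<lambda>n k. \<psi> (real k * tail n) * (a k * conv k n / scale n))"
  obtain H1 where H1: "H1 \<ge> 0" "\<forall>\<^sub>F n in sequentially. \<forall>k\<ge>1.
    a k * conv k n / scale n \<le> H1 * ((real k * tail n) powr \<alpha> *
      max (real k * tail n) (1 / (real k * tail n)) powr \<delta> * exp (- (real k * tail n / 2)))"
    unfolding \<delta>_def using weighted_bound by blast
  obtain H2 where H2: "H2 \<ge> 0" "\<And>z. z > 0 \<Longrightarrow>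
    z powr q * (z powr \<alpha> * max z (1 / z) powr \<delta> * exp (- (z / 2)))
      \<le> H2 * (z powr (- \<beta>) * exp (- (1 / 4 * z)))"
    unfolding \<beta>_def using powr_max_exp_bound[of q \<delta> \<alpha>] q \<alpha> by (auto simp: \<delta>_def)
  have bound: "\<forall>\<^sub>F n in sequentially. \<forall>k\<ge>1. \<bar>c n k\<bar> \<le>
      (H1 * H2) * ((real k * tail n) powr (- \<beta>) * exp (- (1 / 4 * (real k * tail n))))"
    using H1(2) eventually_scale_pos
  proof eventually_elim
    case (elim n)
    show ?case
    proof (intro allI impI)
      fix k :: nat assume k: "k \<ge> 1"
      define z where "z = real k * tail n"
      have z: "z > 0" using k tail_pos[of n] by (simp add: z_def)
      have nn: "a k * conv k n / scale n \<ge> 0"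
        using a_nonneg[OF k] conv_nonneg elim(2) by simp
      then have "\<bar>c n k\<bar> = \<bar>\<psi> z\<bar> * (a k * conv k n / scale n)"
        by (simp only: c_def z_def abs_mult[of "\<psi> (real k * tail n)"] abs_of_nonneg)
      also have "\<dots> \<le> z powr q * (H1 * (z powr \<alpha> * max z (1 / z) powr \<delta> * exp (- (z / 2))))"
        using elim(1) k \<psi>_le z nn by (intro mult_mono) (auto simp: z_def)
      also have "\<dots> = H1 * (z powr q * (z powr \<alpha> * max z (1 / z) powr \<delta> * exp (- (z / 2))))"
        by (simp add: mult_ac)
      also have "\<dots> \<le> H1 * (H2 * (z powr (- \<beta>) * exp (- (1 / 4 * z))))"
        using H1 H2(2)[OF z] by (intro mult_left_mono)
      finally show "\<bar>c n k\<bar> \<le> (H1 * H2) * ((real k * tail n) powr (- \<beta>) * exp (- (1 / 4 * (real k * tail n))))"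
        by (simp add: z_def mult.assoc)
    qed
  qed
  have lim: "AE x in lborel. x > 0 \<longrightarrow> (\<lambda>n. c n (nat \<lceil>x / tail n\<rceil>)) \<longlonglongrightarrow> \<psi> x * (x powr \<alpha> * exp (- x))"
    using \<psi>_cont
  proof eventually_elim
    case (elim x)
    show ?case
    proof
      assume x: "x > 0"
      define K where "K = (\<lambda>n. nat \<lceil>x / tail n\<rceil>)"
      have Kt: "(\<lambda>n. real (K n) * tail n) \<longlonglongrightarrow> x"
        unfolding K_def by (rule window_ceiling(2)[OF x])
      have 1: "(\<lambda>n. a (K n) * conv (K n) n / (scale n *
          ((real (K n) * tail n) powr \<alpha> * exp (- (real (K n) * tail n))))) \<longlonglongrightarrow> 1"
        using filterlim_compose[OF weighted_window window_ceiling(1)[OF x]] x by (simp add: K_def)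
      have 2: "(\<lambda>n. \<psi> (real (K n) * tail n)) \<longlonglongrightarrow> \<psi> x"
        by (rule isCont_tendsto_compose[OF elim Kt])
      have 3: "(\<lambda>n. (real (K n) * tail n) powr \<alpha> * exp (- (real (K n) * tail n)))
          \<longlonglongrightarrow> x powr \<alpha> * exp (- x)"
        using x by (intro tendsto_intros Kt) auto
      have "(\<lambda>n. \<psi> (real (K n) * tail n) * ((a (K n) * conv (K n) n / (scale n *
          ((real (K n) * tail n) powr \<alpha> * exp (- (real (K n) * tail n))))) *
          ((real (K n) * tail n) powr \<alpha> * exp (- (real (K n) * tail n)))))
          \<longlonglongrightarrow> \<psi> x * (1 * (x powr \<alpha> * exp (- x)))"
        by (rule tendsto_mult[OF 2 tendsto_mult[OF 1 3]])
      moreover have "\<forall>\<^sub>F n in sequentially. \<psi> (real (K n) * tail n) * ((a (K n) * conv (K n) n / (scale n *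
          ((real (K n) * tail n) powr \<alpha> * exp (- (real (K n) * tail n))))) *
          ((real (K n) * tail n) powr \<alpha> * exp (- (real (K n) * tail n)))) = c n (K n)"
        using order_tendstoD(1)[OF Kt x]
        by eventually_elim (auto simp: c_def)
      ultimately have "(\<lambda>n. c n (K n)) \<longlonglongrightarrow> \<psi> x * (1 * (x powr \<alpha> * exp (- x)))"
        using Lim_transform_eventually by fast
      then show "(\<lambda>n. c n (nat \<lceil>x / tail n\<rceil>)) \<longlonglongrightarrow> \<psi> x * (x powr \<alpha> * exp (- x))"
        by (simp add: K_def)
    qed
  qed
  have meas: "(\<lambda>x. \<psi> x * (x powr \<alpha> * exp (- x))) \<in> borel_measurable borel"
    using \<psi>_meas by measurable
  have "(0 :: real) < 1 / 4" by simp
  note rs = riemann_sum_dominated[OF tail_pos \<beta> this bound meas lim]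
  have c_eq: "c n (Suc k) = \<psi> (real (Suc k) * tail n) * (a (Suc k) * conv (Suc k) n) * (1 / scale n)" for n k
    by (simp add: c_def)
  show sm: "\<forall>\<^sub>F n in sequentially. summable (\<lambda>k. \<psi> (real (Suc k) * tail n) * (a (Suc k) * conv (Suc k) n))"
    using rs(1) eventually_scale_pos
  proof eventually_elim
    case (elim n)
    from summable_mult2[OF elim(1), of "scale n"] elim(2) show ?case
      by (simp add: c_eq)
  qed
  have "(\<lambda>n. tail n * (\<Sum>k. c n (Suc k))) \<longlonglongrightarrow> (\<integral>x. indicator {0<..} x * (\<psi> x * (x powr \<alpha> * exp (- x))) \<partial>lborel)"
    using rs(2) by simp
  moreover have "\<forall>\<^sub>F n in sequentially. tail n * (\<Sum>k. c n (Suc k)) =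
      tail n * (\<Sum>k. \<psi> (real (Suc k) * tail n) * (a (Suc k) * conv (Suc k) n)) / scale n"
    using sm
  proof eventually_elim
    case (elim n)
    show ?case unfolding c_eq suminf_mult2[OF elim, symmetric] by simp
  qed
  ultimately show "(\<lambda>n. tail n * (\<Sum>k. \<psi> (real (Suc k) * tail n) * (a (Suc k) * conv (Suc k) n)) / scale n)
           \<longlonglongrightarrow> (\<integral>x. indicator {0<..} x * (\<psi> x * (x powr \<alpha> * exp (- x))) \<partial>lborel)"
    using Lim_transform_eventually by fast
qed

end

section \<open>Normalisation: expectations and the local limit\<close>

context weighted_slow_density
begin

definition mass :: "nat \<Rightarrow> real" where
  "mass n = (\<Sum>k. a (Suc k) * conv (Suc k) n)"

lemma mass_summable: "\<forall>\<^sub>F n in sequentially. summable (\<lambda>k. a (Suc k) * conv (Suc k) n)"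
  and mass_tendsto: "(\<lambda>n. tail n * mass n / scale n) \<longlonglongrightarrow> Gamma (\<alpha> + 1)"
  using weighted_sum_tendsto[of 0 "\<lambda>_. 1"] has_bochner_integral_Gamma[of "\<alpha> + 1"] \<alpha>
  by (simp_all add: mass_def has_bochner_integral_iff)

lemma Gamma_pos: "Gamma (\<alpha> + 1) > 0"
  using \<alpha> by (intro Gamma_real_pos) auto

lemma mean_tendsto:
  assumes "q \<ge> 0" "\<psi> \<in> borel_measurable borel" "\<forall>z>0. \<bar>\<psi> z\<bar> \<le> z powr q"
    "AE x in lborel. isCont \<psi> x"
  shows "(\<lambda>n. (\<Sum>k. \<psi> (real (Suc k) * tail n) * (a (Suc k) * conv (Suc k) n)) / mass n)
     \<longlonglongrightarrow> (\<integral>x. indicator {0<..} x * (\<psi> x * (x powr \<alpha> * exp (- x))) \<partial>lborel) / Gamma (\<alpha> + 1)"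
proof (rule Lim_transform_eventually)
  show "(\<lambda>n. (tail n * (\<Sum>k. \<psi> (real (Suc k) * tail n) * (a (Suc k) * conv (Suc k) n)) / scale n) /
      (tail n * mass n / scale n))
     \<longlonglongrightarrow> (\<integral>x. indicator {0<..} x * (\<psi> x * (x powr \<alpha> * exp (- x))) \<partial>lborel) / Gamma (\<alpha> + 1)"
    using Gamma_pos by (intro tendsto_divide weighted_sum_tendsto(2)[OF assms] mass_tendsto) auto
  show "\<forall>\<^sub>F n in sequentially. (tail n * (\<Sum>k. \<psi> (real (Suc k) * tail n) * (a (Suc k) * conv (Suc k) n)) / scale n) /
      (tail n * mass n / scale n) = (\<Sum>k. \<psi> (real (Suc k) * tail n) * (a (Suc k) * conv (Suc k) n)) / mass n"
    using eventually_scale_pos by eventually_elim (use tail_pos in \<open>simp add: less_imp_neq[THEN not_sym]\<close>)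
qed

lemma local_limit:
  assumes c: "c > 0"
  shows "((\<lambda>(n, k). (a k * conv k n / mass n) /
      (tail n * (real k * tail n) powr \<alpha> * exp (- (real k * tail n)) / Gamma (\<alpha> + 1))) \<longlongrightarrow> 1) (window c d)"
proof -
  have "((\<lambda>x. (case x of (n, k) \<Rightarrow> a k * conv k n / (scale n *
      ((real k * tail n) powr \<alpha> * exp (- (real k * tail n))))) *
      (Gamma (\<alpha> + 1) / (case x of (n, k) \<Rightarrow> tail n * mass n / scale n)))
      \<longlongrightarrow> 1 * (Gamma (\<alpha> + 1) / Gamma (\<alpha> + 1))) (window c d)"
    using Gamma_pos
    by (intro tendsto_mult tendsto_divide tendsto_const weighted_window[OF c] window_tendsto mass_tendsto) auto
  then have lim: "((\<lambda>x. (case x of (n, k) \<Rightarrow> a k * conv k n / (scale n *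
      ((real k * tail n) powr \<alpha> * exp (- (real k * tail n))))) *
      (Gamma (\<alpha> + 1) / (case x of (n, k) \<Rightarrow> tail n * mass n / scale n))) \<longlongrightarrow> 1) (window c d)"
    using Gamma_pos by simp
  show ?thesis
  proof (rule Lim_transform_eventually[OF lim])
    show "\<forall>\<^sub>F x in window c d. (case x of (n, k) \<Rightarrow> a k * conv k n / (scale n *
      ((real k * tail n) powr \<alpha> * exp (- (real k * tail n))))) *
      (Gamma (\<alpha> + 1) / (case x of (n, k) \<Rightarrow> tail n * mass n / scale n)) =
      (case x of (n, k) \<Rightarrow> (a k * conv k n / mass n) /
      (tail n * (real k * tail n) powr \<alpha> * exp (- (real k * tail n)) / Gamma (\<alpha> + 1)))"
      using eventually_compose_filterlim[OF eventually_scale_pos window_fst]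
      by eventually_elim (auto simp: field_simps)
  qed
qed

end

section \<open>Slowly varying weights satisfy the hypotheses of the local limit\<close>

lemma sum_inverse_sqrt_le: "(\<Sum>m=1..n. 1 / sqrt (real m)) \<le> 2 * sqrt (real n)"
proof (induction n)
  case (Suc n)
  define x y where "x = sqrt (real n)" and "y = sqrt (real (Suc n))"
  have xy: "0 \<le> x" "x \<le> y" "y > 0" "y * y - x * x = 1" by (auto simp: x_def y_def)
  have "2 * x * y + 1 \<le> 2 * (y * y)"
    using xy(4) zero_le_power2[of "y - x"] by (simp add: power2_eq_square algebra_simps)
  then have "2 * x + 1 / y \<le> 2 * y" using xy by (simp add: field_simps)
  then show ?case using Suc by (simp add: x_def y_def)
qed simp

lemma (in prob_seq) slow_densityI:
  assumes L: "slowly_varying L" and ratio: "(\<lambda>n. real n * p n / L (real n)) \<longlonglongrightarrow> 1"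
  obtains M C where "slow_density p M C"
proof -
  obtain V where V: "\<And>x. V x > 0" "\<forall>\<^sub>F x in at_top. V x = L x"
    and potter: "\<And>x y. x > 0 \<Longrightarrow> y > 0 \<Longrightarrow> V y \<le> exp (1 / 2) * max (y / x) (x / y) powr (1 / 2) * V x"
    using slowly_varying_potter[OF L, of "1 / 2"] by auto
  define M where "M = (\<lambda>n. V (real n))"
  have M_pos: "M n > 0" for n using V by (simp add: M_def)
  have V_eq: "\<forall>\<^sub>F n in sequentially. M n = L (real n)"
    unfolding M_def using eventually_compose_filterlim[OF V(2) filterlim_real_sequentially] .
  have rM: "(\<lambda>n. real n * p n / M n) \<longlonglongrightarrow> 1"
    by (rule Lim_transform_eventually[OF ratio]) (use V_eq in eventually_elim, simp)
  have "Bseq (\<lambda>n. real n * p n / M n)"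
    using rM by (intro convergent_imp_Bseq) (auto simp: convergent_def)
  then obtain K where K: "K > 0" "\<And>n. norm (real n * p n / M n) \<le> K"
    unfolding Bseq_def by blast
  have Kle: "real n * p n \<le> K * M n" for n
  proof -
    have "real n * p n / M n \<le> K" using K(2)[of n] unfolding real_norm_def by (rule abs_le_D1)
    then show ?thesis using M_pos[of n] by (simp add: pos_divide_le_eq)
  qed
  have p_ge: "\<forall>\<^sub>F n in sequentially. M n \<le> 2 * (real n * p n)"
    using order_tendstoD(1)[OF rM, of "1 / 2"]
  proof (rule eventually_mono)
    fix n assume "1 / 2 < real n * p n / M n"
    then show "M n \<le> 2 * (real n * p n)" using M_pos[of n] by (simp add: field_simps)
  qed simp
  \<comment> \<open>For \<open>m \<le> n\<close> the maximum in Potter's bound is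
    \<open>n / m\<close>. The exponent 1/2 is below 1, so the sum over \<open>m\<close> of these
    bounds is still of order \<open>n * M n\<close>.\<close>
  have pot: "M m \<le> 2 * (sqrt (real n / real m) * M n)" if "1 \<le> m" "m \<le> n" for m n
  proof -
    have "real m / real n \<le> 1" "1 \<le> real n / real m" using that by auto
    then have "max (real m / real n) (real n / real m) = real n / real m" by simp
    then have "M m \<le> exp (1 / 2) * (sqrt (real n / real m) * M n)"
      using potter[of "real n" "real m"] that by (simp add: M_def powr_half_sqrt mult.assoc)
    also have "\<dots> \<le> 2 * (sqrt (real n / real m) * M n)"
      using exp_half_le2 M_pos[of n] by (intro mult_right_mono) auto
    finally show ?thesis .
  qed
  \<comment> \<open>\<open>K\<close> bounds \<open>n * p n / M n\<close>; 4 covers both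
    \<open>2 * sqrt 4\<close> in the comparison of \<open>M m\<close> with \<open>M n\<close> and
    \<open>2 * 2\<close> in the sum of \<open>M\<close>.\<close>
  define C where "C = max K 4"
  have C: "C \<ge> K" "C \<ge> 4" by (auto simp: C_def)
  have comparable: "M m \<le> C * M n" if "1 \<le> m" "m \<le> n" "n \<le> 2 * m" for m n
  proof -
    have "real n / real m \<le> 2" using that by (simp add: field_simps)
    then have "sqrt (real n / real m) \<le> sqrt 4" by (intro real_sqrt_le_mono) simp
    then have "2 * (sqrt (real n / real m) * M n) \<le> 2 * (2 * M n)"
      using M_pos[of n] by (intro mult_left_mono mult_right_mono) auto
    also have "\<dots> \<le> C * M n" using C M_pos[of n] by simp
    finally show ?thesis using pot[OF that(1,2)] by linarith
  qed
  have M_sum: "(\<Sum>m=1..n. M m) \<le> C * real n * M n" if "n \<ge> 1" for n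
  proof -
    have "(\<Sum>m=1..n. M m) \<le> (\<Sum>m=1..n. (2 * sqrt (real n) * M n) * (1 / sqrt (real m)))"
      using pot by (intro sum_mono) (auto simp: real_sqrt_divide mult.assoc)
    also have "\<dots> = (2 * sqrt (real n) * M n) * (\<Sum>m=1..n. 1 / sqrt (real m))"
      by (rule sum_distrib_left[symmetric])
    also have "\<dots> \<le> (2 * sqrt (real n) * M n) * (2 * sqrt (real n))"
      using M_pos[of n] by (intro mult_left_mono sum_inverse_sqrt_le) auto
    also have "\<dots> = 4 * real n * M n" by simp
    also have "\<dots> \<le> C * real n * M n" using C M_pos[of n] by (intro mult_right_mono) auto
    finally show ?thesis .
  qed
  have L_pos: "\<forall>\<^sub>F n in sequentially. L (real n) > 0"
    using V_eq by eventually_elim (metis M_pos)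
  \<comment> \<open>For \<open>n < m \<le> R * n\<close> slow variation and \<open>p_ge\<close> each
    lose a factor 2, so \<open>p m \<ge> M n / (4 * m)\<close>, and the harmonic block from
    \<open>n\<close> to \<open>R * n\<close> is at least \<open>ln R - 1\<close>. As
    \<open>R\<close> is arbitrary, the tail outgrows every multiple of \<open>M n\<close>.\<close>
  have tail_large: "\<forall>\<^sub>F n in sequentially. (ln (real R) - 1) / 4 * M n \<le> tail n" if R: "R \<ge> 1" for R :: nat
  proof -
    have "\<forall>\<^sub>F n in sequentially. \<forall>t\<in>{1..real R}. \<bar>L (t * real n) / L (real n) - 1\<bar> < 1 / 2"
      using eventually_compose_filterlim[OF slowly_varying_ratio_uniform[OF L, of 1 "1 / 2" "real R"] filterlim_real_sequentially]
      by simp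
    moreover have "\<forall>\<^sub>F n in sequentially. \<forall>m\<ge>n. M m = L (real m) \<and> M m \<le> 2 * (real m * p m)"
      using eventually_conj[OF V_eq p_ge] by (rule eventually_all_ge_at_top)
    ultimately show ?thesis
      using L_pos eventually_ge_at_top[of 1]
    proof eventually_elim
      case (elim n)
      have "M n / 4 * (1 / real m) \<le> p m" if m: "m \<in> {n<..R * n}" for m
      proof -
        have "real m \<le> real R * real n" using m by (metis greaterThanAtMost_iff of_nat_le_iff of_nat_mult)
        then have t: "real m / real n \<in> {1..real R}" using m elim(4) by (auto simp: field_simps)
        have "\<bar>L (real m) / L (real n) - 1\<bar> < 1 / 2"
          using bspec[OF elim(1) t] elim(4) by simp
        then have "L (real m) / L (real n) > 1 / 2" by linarith
        then have "M n / 2 \<le> M m"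
          using elim(2)[rule_format, of n] elim(2)[rule_format, of m] m elim(3) by (simp add: field_simps)
        also have "M m \<le> 2 * (real m * p m)"
          by (rule conjunct2[OF elim(2)[rule_format]]) (use m in simp)
        finally show ?thesis using m by (simp add: field_simps)
      qed
      then have "(\<Sum>m\<in>{n<..R * n}. M n / 4 * (1 / real m)) \<le> (\<Sum>m\<in>{n<..R * n}. p m)"
        by (rule sum_mono)
      also have "\<dots> = tail n - tail (R * n)" using R by (intro tail_diff[symmetric]) simp
      also have "\<dots> \<le> tail n" using tail_nonneg by simp
      finally have 1: "M n / 4 * (\<Sum>m\<in>{n<..R * n}. 1 / real m) \<le> tail n"
        by (simp only: sum_distrib_left)
      have "harm (R * n) = harm n + (\<Sum>m\<in>{n<..R * n}. 1 / real m)"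
      proof -
        have "{1..N} = {1..n} \<union> {n<..N}" if "n \<le> N" for N using that by auto
        from this[of "R * n"] have "{1..R * n} = {1..n} \<union> {n<..R * n}" using R by simp
        moreover have "{1..n} \<inter> {n<..R * n} = {}" by auto
        ultimately show ?thesis
          unfolding harm_def by (simp only: sum.union_disjoint finite_atLeastAtMost finite_greaterThanAtMost inverse_eq_divide)
      qed
      moreover have "ln (real (R * n)) \<le> ln (real (R * n) + 1)" using R elim(4) by (intro ln_mono) auto
      moreover have "ln (real (R * n) + 1) \<le> harm (R * n)" using ln_le_harm[of "R * n"] by simp
      moreover have "harm n \<le> ln (real n) + (1 :: real)"
        using decseqD[OF decseq_harm_diff_ln, of 0 "n - 1"] elim(4) by (simp add: harm_expand)
      moreover have "ln (real (R * n)) = ln (real R) + ln (real n)" using R elim(4) by (simp add: ln_mult)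
      ultimately have "ln (real R) - 1 \<le> (\<Sum>m\<in>{n<..R * n}. 1 / real m)" by linarith
      then have "M n / 4 * (ln (real R) - 1) \<le> M n / 4 * (\<Sum>m\<in>{n<..R * n}. 1 / real m)"
        using M_pos[of n] by (intro mult_left_mono) auto
      with 1 show ?case by (simp add: mult.commute)
    qed
  qed
  have M_tail: "(\<lambda>n. M n / tail n) \<longlonglongrightarrow> 0"
  proof (rule tendstoI)
    fix \<epsilon> :: real assume \<epsilon>: "\<epsilon> > 0"
    \<comment> \<open>Makes \<open>ln R - 1 \<ge> 8 / \<epsilon>\<close>, hence
      \<open>2 * M n \<le> \<epsilon> * tail n\<close>; the spare factor 2 gives the strict
      inequality.\<close>
    define R where "R = nat \<lceil>exp (1 + 8 / \<epsilon>)\<rceil>"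
    have ge: "real R \<ge> exp (1 + 8 / \<epsilon>)" unfolding R_def by linarith
    then have R0: "real R > 0" by (rule less_le_trans[OF exp_gt_zero])
    have "1 + 8 / \<epsilon> \<le> ln (real R)" using ge ln_ge_iff[OF R0] by blast
    then have R: "ln (real R) - 1 \<ge> 8 / \<epsilon>" "R \<ge> 1" using R0 by auto
    show "\<forall>\<^sub>F n in sequentially. dist (M n / tail n) 0 < \<epsilon>"
      using tail_large[OF R(2)]
    proof eventually_elim
      case (elim n)
      have "8 / \<epsilon> / 4 * M n \<le> (ln (real R) - 1) / 4 * M n"
        using R M_pos[of n] by (intro mult_right_mono divide_right_mono) auto
      also note elim
      finally have 1: "2 * M n \<le> \<epsilon> * tail n" using \<epsilon> by (simp add: field_simps)
      then have "0 < \<epsilon> * tail n" using M_pos[of n] by linarith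
      then have "tail n > 0" using \<epsilon> by (simp add: zero_less_mult_iff)
      moreover have "M n < \<epsilon> * tail n" using 1 M_pos[of n] by linarith
      ultimately show ?case using M_pos[of n] by (simp add: pos_divide_less_eq)
    qed
  qed
  have p_uniform: "\<forall>\<^sub>F n in sequentially. \<forall>m\<le>n. n \<le> 2 * m \<longrightarrow>
      \<bar>real m * p m - real n * p n\<bar> \<le> \<epsilon> * (real n * p n)" if \<epsilon>: "\<epsilon> > 0" for \<epsilon>
  proof -
    \<comment> \<open>With \<open>A = L n\<close> the total error is at most
      \<open>4 * \<eta> * A\<close>. The cap 1/2 gives \<open>L m \<le> 3 / 2 * A\<close> and
      \<open>A \<le> 2 * n * p n\<close>, which turns it into \<open>8 * \<eta>\<close> times
      \<open>n * p n\<close>.\<close>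
    define \<eta> where "\<eta> = min (1 / 2) (\<epsilon> / 8)"
    have \<eta>: "0 < \<eta>" "\<eta> \<le> 1 / 2" "8 * \<eta> \<le> \<epsilon>" using \<epsilon> by (auto simp: \<eta>_def)
    have "\<forall>\<^sub>F n in sequentially. dist (real n * p n / L (real n)) 1 < \<eta> \<and> L (real n) > 0"
      using tendstoD[OF ratio \<eta>(1)] L_pos by eventually_elim simp
    then obtain N where N: "\<And>n. n \<ge> N \<Longrightarrow> dist (real n * p n / L (real n)) 1 < \<eta> \<and> L (real n) > 0"
      unfolding eventually_sequentially by blast
    have "\<forall>\<^sub>F n in sequentially. \<forall>t\<in>{1 / 2..1}. \<bar>L (t * real n) / L (real n) - 1\<bar> < \<eta>"
      using eventually_compose_filterlim[OF slowly_varying_ratio_uniform[OF L, of "1 / 2" \<eta> 1] filterlim_real_sequentially] \<eta>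
      by simp
    then show ?thesis
      using eventually_ge_at_top[of "2 * N + 1"]
    proof eventually_elim
      case (elim n)
      show ?case
      proof (intro allI impI)
        fix m assume m: "m \<le> n" "n \<le> 2 * m"
        have mN: "m \<ge> N" "n \<ge> N" "n \<ge> 1" using elim(2) m by auto
        have close: "\<bar>real j * p j - L (real j)\<bar> \<le> \<eta> * L (real j)" "L (real j) > 0" if "j \<ge> N" for j
        proof -
          show pos: "L (real j) > 0" using N[OF that] by simp
          have "real j * p j - L (real j) = (real j * p j / L (real j) - 1) * L (real j)"
            using pos by (simp add: field_simps)
          then have "\<bar>real j * p j - L (real j)\<bar> = \<bar>real j * p j / L (real j) - 1\<bar> * L (real j)"
            using pos by (simp add: abs_mult)
          also have "\<dots> \<le> \<eta> * L (real j)"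
            using N[OF that] by (intro mult_right_mono) (auto simp: dist_real_def)
          finally show "\<bar>real j * p j - L (real j)\<bar> \<le> \<eta> * L (real j)" .
        qed
        have "real m / real n \<in> {1 / 2..1}" using m mN by (auto simp: field_simps)
        from bspec[OF elim(1) this] have "\<bar>L (real m) / L (real n) - 1\<bar> < \<eta>" using mN by simp
        moreover have "L (real m) - L (real n) = (L (real m) / L (real n) - 1) * L (real n)"
          using close(2)[OF mN(2)] by (simp add: field_simps)
        ultimately have Lmn: "\<bar>L (real m) - L (real n)\<bar> \<le> \<eta> * L (real n)"
          using close(2)[OF mN(2)] by (simp add: abs_mult)
        define A where "A = L (real n)"
        have "\<eta> * A \<le> 1 / 2 * A" using \<eta> close(2)[OF mN(2)] by (intro mult_right_mono) (auto simp: A_def)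
        then have Am: "L (real m) \<le> 3 / 2 * A" using Lmn by (simp add: A_def abs_le_iff)
        have "\<eta> * L (real m) \<le> \<eta> * (3 / 2 * A)" using Am \<eta> by (intro mult_left_mono) auto
        then have tot: "\<bar>real m * p m - real n * p n\<bar> \<le> 4 * (\<eta> * A)"
          using close(1)[OF mN(1)] close(1)[OF mN(2)] Lmn mult_pos_pos[OF \<eta>(1) close(2)[OF mN(2)]]
          unfolding A_def by linarith
        have "A \<le> 2 * (real n * p n)"
          using close(1)[OF mN(2)] \<open>\<eta> * A \<le> 1 / 2 * A\<close> by (simp add: A_def abs_le_iff)
        then have "4 * (\<eta> * A) \<le> 4 * (\<eta> * (2 * (real n * p n)))"
          using \<eta> by (intro mult_left_mono) auto
        also have "\<dots> = (8 * \<eta>) * (real n * p n)" by simp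
        also have "\<dots> \<le> \<epsilon> * (real n * p n)"
          using \<eta> p_nonneg[of n] by (intro mult_right_mono) auto
        finally show "\<bar>real m * p m - real n * p n\<bar> \<le> \<epsilon> * (real n * p n)"
          using tot by linarith
      qed
    qed
  qed
  have "slow_density p M C"
  proof unfold_locales
    show "M n > 0" for n by (rule M_pos)
    show "1 \<le> C" using C by simp
    show "real n * p n \<le> C * M n" for n
      using Kle[of n] mult_right_mono[OF C(1), of "M n"] M_pos[of n] by linarith
    show "\<forall>\<^sub>F n in sequentially. M n \<le> C * (real n * p n)"
      using p_ge
    proof eventually_elim
      case (elim n)
      also have "2 * (real n * p n) \<le> C * (real n * p n)"
        using C p_nonneg[of n] by (intro mult_right_mono) auto
      finally show ?case .
    qed
    show "M m \<le> C * M n" if "1 \<le> m" "m \<le> n" "n \<le> 2 * m" for m n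
      using that by (rule comparable)
    show "(\<Sum>m=1..n. M m) \<le> C * real n * M n" if "1 \<le> n" for n using that by (rule M_sum)
    show "(\<lambda>n. M n / tail n) \<longlonglongrightarrow> 0" by (rule M_tail)
    show "\<forall>\<^sub>F n in sequentially. \<forall>m\<le>n. n \<le> 2 * m \<longrightarrow>
        \<bar>real m * p m - real n * p n\<bar> \<le> \<epsilon> * (real n * p n)" if "\<epsilon> > 0" for \<epsilon>
      using that by (rule p_uniform)
  qed
  then show thesis by (rule that)
qed

subsection \<open>The Gibbs partition model\<close>

lemma finite_comps: "finite (comps k n)"
proof (rule finite_subset)
  show "comps k n \<subseteq> {xs. set xs \<subseteq> {..n} \<and> length xs = k}"
    using member_le_sum_list by (fastforce simp: comps_def)
qed (simp add: finite_lists_length_eq)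

lemma wconv_0: "wconv w 0 n = (if n = 0 then 1 else 0)"
proof -
  have "comps 0 n = (if n = 0 then {[]} else {})" by (auto simp: comps_def)
  then show ?thesis by (simp add: wconv_def)
qed

lemma wconv_Suc: "wconv w (Suc k) n = (\<Sum>m\<le>n. w m * wconv w k (n - m))"
proof -
  have "wconv w (Suc k) n = (\<Sum>(m, xs)\<in>(SIGMA m:{..n}. comps k (n - m)). w m * prod_list (map w xs))"
    unfolding wconv_def
    by (rule sum.reindex_bij_witness[of _ "\<lambda>(m, xs). m # xs" "\<lambda>xs. (hd xs, tl xs)"])
      (auto simp: comps_def length_Suc_conv)
  then show ?thesis
    by (simp add: sum.Sigma[symmetric] finite_comps wconv_def sum_distrib_left)
qed

text \<open>Exponential tilting: the factors \<open>\<rho> ^ m / W\<close> along a composition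
  multiply to a quantity that depends only on its sum and its length.\<close>

lemma (in prob_seq) conv_eq_wconv:
  assumes p: "\<And>m. p m = w m * \<rho> ^ m / W"
  shows "conv k n = wconv w k n * \<rho> ^ n / W ^ k"
proof (induction k arbitrary: n)
  case 0
  then show ?case by (simp add: conv_0 wconv_0)
next
  case (Suc k)
  have "p m * conv k (n - m) = w m * wconv w k (n - m) * (\<rho> ^ n / W ^ Suc k)" if "m \<le> n" for m
    using that by (simp add: p Suc power_add[symmetric] flip: mult.assoc)
  then show ?case by (simp add: conv_Suc wconv_Suc sum_distrib_right sum_divide_distrib)
qed

lemma (in prob_seq) tail_X_eq_tail:
  assumes p: "\<And>m. p m = w m * \<rho> ^ m / gen_fun w \<rho>"
  shows "tail_X w \<rho> n = tail n"
proof -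
  have "(\<lambda>m. p m - (if m \<in> {..n} then p m else 0)) sums (1 - (\<Sum>m\<in>{..n}. p m))"
    by (intro sums_diff p_sums sums_If_finite_set) simp
  also have "(\<lambda>m. p m - (if m \<in> {..n} then p m else 0)) = (\<lambda>m. (if n < m then w m * \<rho> ^ m else 0) * (1 / gen_fun w \<rho>))"
    by (auto simp: p fun_eq_iff)
  finally have sums: "(\<lambda>m. (if n < m then w m * \<rho> ^ m else 0) * (1 / gen_fun w \<rho>)) sums tail n"
    by (simp add: tail_def cdf_def)
  \<comment> \<open>Division by zero yields 0, so a vanishing normaliser would make \<open>p\<close>
    identically 0, against its total mass 1.\<close>
  have W: "gen_fun w \<rho> \<noteq> 0"
  proof
    assume "gen_fun w \<rho> = 0"
    then have "p = (\<lambda>_. 0)" using p by (simp add: fun_eq_iff)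
    then have "p sums 0" by simp
    from sums_unique2[OF p_sums this] show False by simp
  qed
  from sums_mult2[OF sums, of "gen_fun w \<rho>"] W show ?thesis
    by (simp add: tail_X_def sums_iff)
qed

text \<open>Both series have the same limits, if any, so the values of \<open>suminf\<close> agree
  even for a divergent series.\<close>

lemma suminf_shift_0:
  fixes f :: "nat \<Rightarrow> real"
  assumes "f 0 = 0"
  shows "(\<Sum>k. f (Suc k)) = suminf f"
proof -
  have "(\<lambda>k. f (Suc k)) sums s \<longleftrightarrow> f sums s" for s
    using sums_Suc_iff[of f s] assms by simp
  then show ?thesis by (simp add: suminf_def)
qed

section \<open>The law of the number of components\<close>

context weighted_slow_density
begin

definition prob :: "nat \<Rightarrow> nat \<Rightarrow> real" where
  "prob n k = (if k = 0 then 0 else a k * conv k n / mass n)"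

lemma local_limit_uniform:
  assumes K: "compact K" "K \<subseteq> {0<..}" and \<epsilon>: "\<epsilon> > 0"
  shows "\<forall>\<^sub>F n in sequentially. \<forall>k. real k * tail n \<in> K \<longrightarrow>
    \<bar>prob n k / (tail n * (real k * tail n) powr \<alpha> * exp (- (real k * tail n)) / Gamma (\<alpha> + 1)) - 1\<bar> < \<epsilon>"
proof (cases "K = {}")
  case False
  obtain c where c: "c \<in> K" "\<And>x. x \<in> K \<Longrightarrow> c \<le> x"
    using compact_attains_inf[OF K(1) False] by blast
  obtain d where d: "\<And>x. x \<in> K \<Longrightarrow> x \<le> d"
    using compact_attains_sup[OF K(1) False] by blast
  have "c > 0" using c K by auto
  have "\<forall>\<^sub>F n in sequentially. \<forall>k. real k * tail n \<in> {c..d} \<longrightarrow>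
      dist ((a k * conv k n / mass n) /
      (tail n * (real k * tail n) powr \<alpha> * exp (- (real k * tail n)) / Gamma (\<alpha> + 1))) 1 < \<epsilon>"
    using tendstoD[OF local_limit[OF \<open>c > 0\<close>, of d] \<epsilon>] unfolding eventually_window prod.case .
  then show ?thesis
  proof eventually_elim
    case (elim n)
    show ?case
    proof (intro allI impI)
      fix k assume k: "real k * tail n \<in> K"
      have "k \<noteq> 0"
      proof
        assume "k = 0"
        then have "0 \<in> K" using k by simp
        then show False using K by auto
      qed
      then show "\<bar>prob n k / (tail n * (real k * tail n) powr \<alpha> * exp (- (real k * tail n)) / Gamma (\<alpha> + 1)) - 1\<bar> < \<epsilon>"
        using elim c(2)[OF k] d[OF k] by (simp add: prob_def dist_real_def)
    qed
  qed
qed simp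

lemma prob_weighted_sum:
  "(\<lambda>k. \<psi> (real (Suc k) * tail n) * prob n (Suc k)) =
   (\<lambda>k. \<psi> (real (Suc k) * tail n) * (a (Suc k) * conv (Suc k) n) / mass n)"
  by (simp add: prob_def)

lemma prob_distribution_tendsto:
  "(\<lambda>n. \<Sum>k. if real k * tail n \<le> x then prob n k else 0) \<longlonglongrightarrow> gamma_cdf (\<alpha> + 1) x"
proof (cases "x > 0")
  case False
  have "(if real k * tail n \<le> x then prob n k else 0) = 0" for n k
  proof (cases "k = 0")
    case False
    then have "real k * tail n > 0" using tail_pos by simp
    then show ?thesis using \<open>\<not> x > 0\<close> by simp
  qed (simp add: prob_def)
  then show ?thesis using False by (simp add: gamma_cdf_def)
next
  case True
  \<comment> \<open>Bounded by \<open>z powr 0\<close> and discontinuous only at \<open>x\<close>, a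
    null set; this fits the almost everywhere form of the weighted limit.\<close>
  define \<psi> where "\<psi> = (indicator {..x} :: real \<Rightarrow> real)"
  have \<psi>: "\<psi> \<in> borel_measurable borel" "\<forall>z>0. \<bar>\<psi> z\<bar> \<le> z powr 0"
    by (auto simp: \<psi>_def indicator_def)
  have cont: "AE z in lborel. isCont \<psi> z"
    using AE_lborel_singleton[of x]
  proof eventually_elim
    case (elim z)
    then have "z \<notin> frontier {..x}" by simp
    then show ?case unfolding \<psi>_def by (rule isCont_indicator[THEN iffD2])
  qed
  have int: "(\<integral>z. indicator {0<..} z * (\<psi> z * (z powr \<alpha> * exp (- z))) \<partial>lborel) / Gamma (\<alpha> + 1) = gamma_cdf (\<alpha> + 1) x"
  proof -
    have "(\<integral>z. indicator {0<..} z * (\<psi> z * (z powr \<alpha> * exp (- z))) \<partial>lborel) =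
        (\<integral>z. indicator {0..x} z *\<^sub>R (z powr (\<alpha> + 1 - 1) * exp (- z)) \<partial>lborel)"
      by (intro Bochner_Integration.integral_cong) (auto simp: \<psi>_def indicator_def)
    then show ?thesis using True by (simp add: gamma_cdf_def set_lebesgue_integral_def)
  qed
  have "(\<lambda>n. (\<Sum>k. \<psi> (real (Suc k) * tail n) * (a (Suc k) * conv (Suc k) n)) / mass n) \<longlonglongrightarrow> gamma_cdf (\<alpha> + 1) x"
    using mean_tendsto[OF order_refl \<psi> cont] unfolding int .
  moreover have "\<forall>\<^sub>F n in sequentially.
      (\<Sum>k. \<psi> (real (Suc k) * tail n) * (a (Suc k) * conv (Suc k) n)) / mass n =
      (\<Sum>k. if real k * tail n \<le> x then prob n k else 0)"
    using weighted_sum_tendsto(1)[OF order_refl \<psi> cont]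
  proof eventually_elim
    case (elim n)
    let ?f = "\<lambda>k. if real k * tail n \<le> x then prob n k else 0"
    have "suminf ?f = (\<Sum>k. ?f (Suc k))"
      by (rule suminf_shift_0[symmetric]) (simp add: prob_def)
    also have "\<dots> = (\<Sum>k. \<psi> (real (Suc k) * tail n) * prob n (Suc k))"
      by (intro suminf_cong) (simp add: \<psi>_def indicator_def)
    also have "\<dots> = (\<Sum>k. \<psi> (real (Suc k) * tail n) * (a (Suc k) * conv (Suc k) n)) / mass n"
      unfolding prob_weighted_sum by (rule suminf_divide[OF elim])
    finally show ?case by simp
  qed
  ultimately show ?thesis by (rule Lim_transform_eventually)
qed

lemma prob_moment:
  fixes q :: real
  assumes q: "q \<ge> 1"
  shows "\<forall>\<^sub>F n in sequentially. summable (\<lambda>k. real k powr q * prob n k)"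
    and "(\<lambda>n. \<Sum>k. real k powr q * prob n k) \<sim>[sequentially]
      (\<lambda>n. tail n powr (- q) * Gamma (q + \<alpha> + 1) / Gamma (\<alpha> + 1))"
proof -
  \<comment> \<open>The absolute value makes the test function continuous on the whole line, 0
    included, and changes nothing at the positive points \<open>k * tail n\<close>.\<close>
  define \<psi> where "\<psi> = (\<lambda>z :: real. \<bar>z\<bar> powr q)"
  have q0: "q \<ge> 0" using q by simp
  have \<psi>: "\<psi> \<in> borel_measurable borel" "\<forall>z>0. \<bar>\<psi> z\<bar> \<le> z powr q"
    by (auto simp: \<psi>_def)
  have cont: "AE z in lborel. isCont \<psi> z"
    unfolding \<psi>_def using q
    by (intro AE_I2) (auto simp: isCont_def intro!: tendsto_powr' tendsto_intros)
  have \<psi>_eq: "\<psi> (real k * tail n) = tail n powr q * real k powr q" for k n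
    using tail_pos[of n] by (simp add: \<psi>_def abs_mult powr_mult mult.commute)
  have int: "(\<integral>z. indicator {0<..} z * (\<psi> z * (z powr \<alpha> * exp (- z))) \<partial>lborel) = Gamma (q + \<alpha> + 1)"
  proof -
    have "(\<integral>z. indicator {0<..} z * (\<psi> z * (z powr \<alpha> * exp (- z))) \<partial>lborel) =
        (\<integral>z. indicator {0<..} z * (z powr (q + \<alpha> + 1 - 1) * exp (- z)) \<partial>lborel)"
      by (intro Bochner_Integration.integral_cong) (auto simp: \<psi>_def indicator_def powr_add)
    then show ?thesis
      using has_bochner_integral_Gamma[of "q + \<alpha> + 1"] q \<alpha> by (simp add: has_bochner_integral_iff)
  qed
  have Gq: "Gamma (q + \<alpha> + 1) > 0" using q \<alpha> by (intro Gamma_real_pos) auto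
  note sm = weighted_sum_tendsto(1)[OF q0 \<psi> cont]
  have terms: "real (Suc k) powr q * prob n (Suc k) =
      (\<psi> (real (Suc k) * tail n) * (a (Suc k) * conv (Suc k) n) / mass n) * (1 / tail n powr q)" for n k
    using tail_pos[of n] unfolding \<psi>_eq by (simp add: prob_def)
  show "\<forall>\<^sub>F n in sequentially. summable (\<lambda>k. real k powr q * prob n k)"
    using sm
  proof eventually_elim
    case (elim n)
    have "summable (\<lambda>k. real (Suc k) powr q * prob n (Suc k))"
      unfolding terms by (rule summable_mult2[OF summable_divide[OF elim]])
    then show ?case by (rule summable_Suc_iff[THEN iffD1])
  qed
  have "(\<lambda>n. (\<Sum>k. \<psi> (real (Suc k) * tail n) * (a (Suc k) * conv (Suc k) n)) / mass n
      / (Gamma (q + \<alpha> + 1) / Gamma (\<alpha> + 1))) \<longlonglongrightarrow> (Gamma (q + \<alpha> + 1) / Gamma (\<alpha> + 1)) / (Gamma (q + \<alpha> + 1) / Gamma (\<alpha> + 1))"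
    using Gamma_pos Gq
    by (intro tendsto_divide[OF mean_tendsto[OF q0 \<psi> cont, unfolded int] tendsto_const]) simp
  moreover have "(Gamma (q + \<alpha> + 1) / Gamma (\<alpha> + 1)) / (Gamma (q + \<alpha> + 1) / Gamma (\<alpha> + 1)) = 1"
    using Gamma_pos Gq by simp
  ultimately have lim: "(\<lambda>n. (\<Sum>k. \<psi> (real (Suc k) * tail n) * (a (Suc k) * conv (Suc k) n)) / mass n
      / (Gamma (q + \<alpha> + 1) / Gamma (\<alpha> + 1))) \<longlonglongrightarrow> 1"
    by (simp only:)
  show "(\<lambda>n. \<Sum>k. real k powr q * prob n k) \<sim>[sequentially]
      (\<lambda>n. tail n powr (- q) * Gamma (q + \<alpha> + 1) / Gamma (\<alpha> + 1))"
  proof (rule asymp_equivI', rule Lim_transform_eventually[OF lim])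
    show "\<forall>\<^sub>F n in sequentially. (\<Sum>k. \<psi> (real (Suc k) * tail n) * (a (Suc k) * conv (Suc k) n)) / mass n
      / (Gamma (q + \<alpha> + 1) / Gamma (\<alpha> + 1)) =
      (\<Sum>k. real k powr q * prob n k) / (tail n powr (- q) * Gamma (q + \<alpha> + 1) / Gamma (\<alpha> + 1))"
      using sm
    proof eventually_elim
      case (elim n)
      have "(\<Sum>k. real k powr q * prob n k) = (\<Sum>k. real (Suc k) powr q * prob n (Suc k))"
        by (rule suminf_shift_0[symmetric]) simp
      also have "\<dots> = (\<Sum>k. \<psi> (real (Suc k) * tail n) * (a (Suc k) * conv (Suc k) n)) / mass n * (1 / tail n powr q)"
        unfolding terms suminf_divide[OF elim, symmetric] by (rule suminf_mult2[OF summable_divide[OF elim], symmetric])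
      finally show ?case using tail_pos[of n] by (simp add: powr_minus field_simps)
    qed
  qed
qed

end

theorem theorem1p1:
  fixes w v :: "nat \<Rightarrow> real" and \<rho> \<alpha> :: real and Lw Lv :: "real \<Rightarrow> real"
  assumes w_nonneg: "\<forall>n. w n \<ge> 0"
    and v_nonneg: "\<forall>k\<ge>1. v k \<ge> 0"
    and rho_pos: "\<rho> > 0"
    and alpha: "\<alpha> > -1"
    and Lw: "slowly_varying Lw" and Lv: "slowly_varying Lv"
    and w_asymp: "(\<lambda>n. w n) \<sim>[sequentially] (\<lambda>n. Lw (real n) * real n powr (-1) / \<rho> ^ n)"
    and W_fin: "summable (\<lambda>m. w m * \<rho> ^ m)" and W_pos: "gen_fun w \<rho> > 0"
    and v_asymp: "(\<lambda>n. v n) \<sim>[sequentially]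
                    (\<lambda>n. Lv (real n) * real n powr (\<alpha> - 1) / gen_fun w \<rho> ^ n)"
  defines "F \<equiv> inf sequentially (principal {n. gibbs_admissible v w n})"
  shows
    "(\<forall>K :: real set. compact K \<and> K \<subseteq> {0<..} \<longrightarrow>
       (\<forall>\<epsilon>>0. \<forall>\<^sub>F n in F. \<forall>k::nat. real k * tail_X w \<rho> n \<in> K \<longrightarrow>
          \<bar>gibbs_prob v w n k /
             (tail_X w \<rho> n * (real k * tail_X w \<rho> n) powr \<alpha> * exp (- (real k * tail_X w \<rho> n))
               / Gamma (\<alpha> + 1)) - 1\<bar> < \<epsilon>))
     \<and> (\<forall>x. isCont (gamma_cdf (\<alpha> + 1)) x \<longrightarrow>
          ((\<lambda>n. \<Sum>k. if real k * tail_X w \<rho> n \<le> x then gibbs_prob v w n k else 0)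
             \<longlongrightarrow> gamma_cdf (\<alpha> + 1) x) F)
     \<and> (\<forall>q\<ge>1. (\<forall>\<^sub>F n in F. summable (\<lambda>k. real k powr q * gibbs_prob v w n k)) \<and>
          (\<lambda>n. \<Sum>k. real k powr q * gibbs_prob v w n k) \<sim>[F]
          (\<lambda>n. tail_X w \<rho> n powr (- q) * Gamma (q + \<alpha> + 1) / Gamma (\<alpha> + 1)))"
proof -
  define W where "W = gen_fun w \<rho>"
  define p where "p = (\<lambda>m. w m * \<rho> ^ m / W)"
  \<comment> \<open>Cancels the factor \<open>W ^ k\<close> in the asymptotics of \<open>v\<close>,
    leaving a regularly varying weight of index \<alpha> - 1.\<close>
  define a where "a = (\<lambda>k. v k * W ^ k)"
  have W: "W > 0" using W_pos by (simp add: W_def)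
  interpret prob_seq p
  proof
    show "p m \<ge> 0" for m using w_nonneg rho_pos W by (simp add: p_def)
    show "p sums 1"
      using sums_divide[OF summable_sums[OF W_fin], of W] W by (simp add: p_def W_def gen_fun_def)
  qed
  define L where "L = (\<lambda>x. Lw x / W)"
  have L: "slowly_varying L"
    using Lw W unfolding slowly_varying_def L_def by (auto elim: eventually_mono)
  have L_pos: "\<forall>\<^sub>F n in sequentially. Lw (real n) > 0"
    by (rule eventually_compose_filterlim[OF _ filterlim_real_sequentially])
      (use Lw in \<open>simp add: slowly_varying_def\<close>)
  have "(\<lambda>n. real n * p n / L (real n)) \<longlonglongrightarrow> 1"
  proof (rule Lim_transform_eventually)
    show "(\<lambda>n. w n / (Lw (real n) * real n powr (-1) / \<rho> ^ n)) \<longlonglongrightarrow> 1"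
    proof (rule asymp_equivD_strong[OF w_asymp])
      show "\<forall>\<^sub>F n in sequentially. w n \<noteq> 0 \<or> Lw (real n) * real n powr (-1) / \<rho> ^ n \<noteq> 0"
        using L_pos eventually_gt_at_top[of 0] by eventually_elim (use rho_pos in auto)
    qed
    show "\<forall>\<^sub>F n in sequentially. w n / (Lw (real n) * real n powr (-1) / \<rho> ^ n) = real n * p n / L (real n)"
      using L_pos eventually_gt_at_top[of 0]
      by eventually_elim (use W rho_pos in \<open>simp add: p_def L_def powr_minus field_simps\<close>)
  qed
  then obtain M C where MC: "slow_density p M C" using slow_densityI[OF L] by blast
  obtain V where V: "\<And>x. V x > 0" "\<forall>\<^sub>F x in at_top. V x = Lv x"
    "\<And>x y. x > 0 \<Longrightarrow> y > 0 \<Longrightarrow> V y \<le> exp ((\<alpha> + 1) / 2) * max (y / x) (x / y) powr ((\<alpha> + 1) / 2) * V x"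
    using slowly_varying_potter[OF Lv, of "(\<alpha> + 1) / 2"] alpha by auto
  have a_asymp: "a \<sim>[sequentially] (\<lambda>k. Lv (real k) * real k powr (\<alpha> - 1))"
  proof -
    have "(\<lambda>k. v k * W ^ k) \<sim>[sequentially] (\<lambda>k. Lv (real k) * real k powr (\<alpha> - 1) / W ^ k * W ^ k)"
      using v_asymp unfolding W_def by (intro asymp_equiv_mult asymp_equiv_refl)
    then show ?thesis using W by (simp add: a_def)
  qed
  interpret slow_density p M C by (rule MC)
  interpret weighted_slow_density p M C a \<alpha> Lv V
    by unfold_locales (use alpha v_nonneg W Lv a_asymp V in \<open>auto simp: a_def\<close>)
  have tail_eq: "tail_X w \<rho> n = tail n" for n
    by (rule tail_X_eq_tail) (simp add: p_def W_def)
  \<comment> \<open>The powers of \<open>W\<close> in \<open>a k\<close> and in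
    \<open>conv k n\<close> cancel; the remaining \<open>\<rho> ^ n\<close> does not depend on
    \<open>k\<close> and disappears in the normalisation, so the Gibbs law equals
    \<open>prob n\<close> as soon as the mass is summable.\<close>
  have gibbs_term: "v k * wconv w k n = a k * conv k n / \<rho> ^ n" for k n
    using conv_eq_wconv[of w \<rho> W k n] W rho_pos by (simp add: p_def a_def)
  have "\<forall>\<^sub>F n in sequentially. gibbs_prob v w n = prob n"
    using mass_summable
  proof eventually_elim
    case (elim n)
    have "gibbs_u v w n = mass n / \<rho> ^ n"
      unfolding gibbs_u_def gibbs_term mass_def by (rule suminf_divide[OF elim])
    then show ?case
      using rho_pos by (auto simp: fun_eq_iff gibbs_prob_def prob_def gibbs_term)
  qed
  moreover have F: "F \<le> sequentially" by (simp add: F_def)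
  ultimately have eq: "\<forall>\<^sub>F n in F. gibbs_prob v w n = prob n" using filter_leD by blast
  show ?thesis
  proof (intro conjI allI impI)
    fix K :: "real set" and \<epsilon> :: real assume K: "compact K \<and> K \<subseteq> {0<..}" and \<epsilon>: "\<epsilon> > 0"
    from filter_leD[OF F local_limit_uniform[OF conjunct1[OF K] conjunct2[OF K] \<epsilon>]] eq
    show "\<forall>\<^sub>F n in F. \<forall>k::nat. real k * tail_X w \<rho> n \<in> K \<longrightarrow>
          \<bar>gibbs_prob v w n k /
             (tail_X w \<rho> n * (real k * tail_X w \<rho> n) powr \<alpha> * exp (- (real k * tail_X w \<rho> n))
               / Gamma (\<alpha> + 1)) - 1\<bar> < \<epsilon>"
      unfolding tail_eq by eventually_elim simp
  next
    fix x
    show "((\<lambda>n. \<Sum>k. if real k * tail_X w \<rho> n \<le> x then gibbs_prob v w n k else 0)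
             \<longlongrightarrow> gamma_cdf (\<alpha> + 1) x) F"
      unfolding tail_eq
    proof (rule Lim_transform_eventually[OF filterlim_mono[OF prob_distribution_tendsto order_refl F]])
      show "\<forall>\<^sub>F n in F. (\<Sum>k. if real k * tail n \<le> x then prob n k else 0) =
          (\<Sum>k. if real k * tail n \<le> x then gibbs_prob v w n k else 0)"
        using eq by eventually_elim (simp cong: if_cong)
    qed
  next
    fix q :: real assume q: "q \<ge> 1"
    from filter_leD[OF F prob_moment(1)[OF q]] eq
    show "\<forall>\<^sub>F n in F. summable (\<lambda>k. real k powr q * gibbs_prob v w n k)"
      by eventually_elim simp
    have "(\<lambda>n. \<Sum>k. real k powr q * prob n k) \<sim>[F]
          (\<lambda>n. tail n powr (- q) * Gamma (q + \<alpha> + 1) / Gamma (\<alpha> + 1))"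
      using prob_moment(2)[OF q] F unfolding asymp_equiv_def by (auto intro: filterlim_mono)
    then show "(\<lambda>n. \<Sum>k. real k powr q * gibbs_prob v w n k) \<sim>[F]
          (\<lambda>n. tail_X w \<rho> n powr (- q) * Gamma (q + \<alpha> + 1) / Gamma (\<alpha> + 1))"
      unfolding tail_eq
    proof (rule asymp_equiv_transfer)
      show "\<forall>\<^sub>F n in F. (\<Sum>k. real k powr q * prob n k) = (\<Sum>k. real k powr q * gibbs_prob v w n k)"
        using eq by eventually_elim simp
    qed simp
  qed
qed

end
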